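(* Let $0\le a<b<+\infty$, $\rho>0$, $0<\alpha\le 1$, let $m$ be a non-negative integer, and let $f:[a,b]\to\mathbb{R}$. (Left version) Suppose that $\mathcal{C}^{j\alpha,\rho}_{a^+}f$ is defined and belongs to $C[a,b]$ for $j=0,1,\dots,m+1$. Then for every $x\in(a,b]$ there exists $\xi\in(a,x)$ such that $$f(x)=\sum_{j=0}^m\left(\frac{x^\rho-a^\rho}{\rho}\right)^{j\alpha}\frac{\mathcal{C}^{j\alpha,\rho}_{a^+}f(a)}{\Gamma(j\alpha+1)}+\left(\frac{x^\rho-a^\rho}{\rho}\right)^{(m+1)\alpha}\frac{\mathcal{C}^{(m+1)\alpha,\rho}_{a^+}f(\xi)}{\Gamma((m+1)\alpha+1)}.$$ (Right version) Suppose that $\mathcal{C}^{j\alpha,\rho}_{b^-}f$ is defined and belongs to $C[a,b]$ for $j=0,1,\dots,m+1$. Then for every $x\in[a,b)$ there exists $\xi\in(x,b)$ such that $$f(x)=\sum_{j=0}^m\left(\frac{b^\rho-x^\rho}{\rho}\right)^{j\alpha}\frac{\mathcal{C}^{j\alpha,\rho}_{b^-}f(b)}{\Gamma(j\alpha+1)}+\left(\frac{b^\rho-x^\rho}{\rho}\right)^{(m+1)\alpha}\frac{\mathcal{C}^{(m+1)\alpha,\rho}_{b^-}f(\xi)}{\Gamma((m+1)\alpha+1)}.$$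
   Context: Let $\gamma:=x^{1-\rho}\frac{d}{dx}$. For $\beta>0$ the left and right generalized fractional integrals are $$\mathcal{I}^{\beta,\rho}_{a^+}g(x)=\frac{\rho^{1-\beta}}{\Gamma(\beta)}\int_a^x\frac{\tau^{\rho-1}g(\tau)}{(x^\rho-\tau^\rho)^{1-\beta}}\,d\tau\ (x>a),\qquad \mathcal{I}^{\beta,\rho}_{b^-}g(x)=\frac{\rho^{1-\beta}}{\Gamma(\beta)}\int_x^b\frac{\tau^{\rho-1}g(\tau)}{(\tau^\rho-x^\rho)^{1-\beta}}\,d\tau\ (x<b).$$ For an absolutely continuous $g\in AC[a,b]$ and $0<\alpha\le1$, the left and right generalized Caputo fractional derivatives are, for $0<\alpha<1$, $$\mathcal{C}^{\alpha,\rho}_{a^+}g:=\gamma\,\mathcal{I}^{1-\alpha,\rho}_{a^+}\big(g-g(a)\big),\qquad \mathcal{C}^{\alpha,\rho}_{b^-}g:=-\gamma\,\mathcal{I}^{1-\alpha,\rho}_{b^-}\big(g-g(b)\big),$$ and for $\alpha=1$, $\mathcal{C}^{1,\rho}_{a^+}g:=\gamma g$, $\mathcal{C}^{1,\rho}_{b^-}g:=-\gamma g$. These are defined almost everywhere on $[a,b]$; "belongs to $C[a,b]$" means that the function agrees almost everywhere with a continuous function on $[a,b]$, with which it is identified (so values at $a$ and $b$ make sense). $\mathcal{C}^{j\alpha,\rho}_{a^+}f:=\mathcal{C}^{\alpha,\rho}_{a^+}\circ\cdots\circ\mathcal{C}^{\alpha,\rho}_{a^+}f$ ($j$ times) denotes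 the $j$-fold composition, with $\mathcal{C}^{0,\rho}_{a^+}f:=f$, and similarly for $b^-$. That $\mathcal{C}^{j\alpha,\rho}_{a^+}f$ is defined means that $\mathcal{C}^{i\alpha,\rho}_{a^+}f\in AC[a,b]$ for every $0\le i<j$ (similarly for $b^-$). *)

theory Defs
  imports "HOL-Analysis.Analysis"
begin

definition abs_cont_on :: "real \<Rightarrow> real \<Rightarrow> (real \<Rightarrow> real) \<Rightarrow> bool" where
  "abs_cont_on a b g \<longleftrightarrow>
     (\<forall>\<epsilon>>0. \<exists>\<delta>>0. \<forall>(n::nat) (u::nat \<Rightarrow> real) v.
        (\<forall>i<n. a \<le> u i \<and> u i \<le> v i \<and> v i \<le> b) \<longrightarrow>
        (\<forall>i<n. \<forall>j<n. i \<noteq> j \<longrightarrow> {u i<..<v i} \<inter> {u j<..<v j} = {}) \<longrightarrow>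
        (\<Sum>i<n. v i - u i) < \<delta> \<longrightarrow>
        (\<Sum>i<n. \<bar>g (v i) - g (u i)\<bar>) < \<epsilon>)"

definition frac_int_left :: "real \<Rightarrow> real \<Rightarrow> real \<Rightarrow> (real \<Rightarrow> real) \<Rightarrow> real \<Rightarrow> real" where
  "frac_int_left \<beta> \<rho> a g x =
     \<rho> powr (1 - \<beta>) / Gamma \<beta> *
     (LINT \<tau>:{a..x}|lebesgue.
        \<tau> powr (\<rho> - 1) * g \<tau> / (x powr \<rho> - \<tau> powr \<rho>) powr (1 - \<beta>))"

definition frac_int_right :: "real \<Rightarrow> real \<Rightarrow> real \<Rightarrow> (real \<Rightarrow> real) \<Rightarrow> real \<Rightarrow> real" where
  "frac_int_right \<beta> \<rho> b g x =
     \<rho> powr (1 - \<beta>) / Gamma \<beta> *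
     (LINT \<tau>:{x..b}|lebesgue.
        \<tau> powr (\<rho> - 1) * g \<tau> / (\<tau> powr \<rho> - x powr \<rho>) powr (1 - \<beta>))"

text \<open>
  Functions that are only defined almost everywhere are partial functions: the derivative
  \<open>x\<^sup>1\<^sup>-\<^sup>\<rho> d/dx\<close> has the value \<^const>\<open>None\<close> at points of non-differentiability.
  (At the end points of \<open>[a,b]\<close> the two-sided derivative depends on values outside \<open>[a,b]\<close>;
  this is harmless, because only almost every point of \<open>[a,b]\<close> matters below.)
\<close>

definition gamma_op :: "real \<Rightarrow> (real \<Rightarrow> real) \<Rightarrow> real \<Rightarrow> real option" where
  "gamma_op \<rho> G x =
     (if G differentiable (at x) then Some (x powr (1 - \<rho>) * deriv G x) else None)"

definition caputo_left ::
    "real \<Rightarrow> real \<Rightarrow> real \<Rightarrow> (real \<Rightarrow> real) \<Rightarrow> real \<Rightarrow> real option" where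
  "caputo_left \<alpha> \<rho> a g =
     (if \<alpha> = 1 then gamma_op \<rho> g
      else gamma_op \<rho> (frac_int_left (1 - \<alpha>) \<rho> a (\<lambda>t. g t - g a)))"

definition caputo_right ::
    "real \<Rightarrow> real \<Rightarrow> real \<Rightarrow> (real \<Rightarrow> real) \<Rightarrow> real \<Rightarrow> real option" where
  "caputo_right \<alpha> \<rho> b g =
     (\<lambda>x. map_option uminus
       ((if \<alpha> = 1 then gamma_op \<rho> g
         else gamma_op \<rho> (frac_int_right (1 - \<alpha>) \<rho> b (\<lambda>t. g t - g b))) x))"

definition continuous_version ::
    "real \<Rightarrow> real \<Rightarrow> (real \<Rightarrow> real option) \<Rightarrow> (real \<Rightarrow> real) \<Rightarrow> bool" where
  "continuous_version a b u h \<longleftrightarrow>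
     continuous_on {a..b} h \<and> (AE x\<in>{a..b} in lebesgue. u x = Some (h x))"

text \<open>
  \<open>iter_op a b D j f\<close> is the \<open>j\<close>-fold composition of \<open>D\<close> applied to \<open>f\<close>, where after every
  application of \<open>D\<close> the result is identified with its continuous version on \<open>[a,b]\<close>.  For
  \<open>a < b\<close> this version is unique on \<open>[a,b]\<close> if it exists; if it does not, the value is
  arbitrary, so \<open>iter_op a b D j f\<close> is meaningful only together with \<open>iter_defined a b D j f\<close>
  and \<open>iter_in_C a b D j f\<close>.
\<close>

primrec iter_op ::
    "real \<Rightarrow> real \<Rightarrow> ((real \<Rightarrow> real) \<Rightarrow> real \<Rightarrow> real option) \<Rightarrow> nat \<Rightarrow> (real \<Rightarrow> real) \<Rightarrow> real \<Rightarrow> real"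
where
  "iter_op a b D 0 f = f"
| "iter_op a b D (Suc j) f = (SOME h. continuous_version a b (D (iter_op a b D j f)) h)"

text \<open>
  The \<open>j\<close>-th iterate belongs to \<open>C[a,b]\<close>.  The \<open>0\<close>-th iterate is the everywhere defined
  function \<open>f\<close> itself, so no identification takes place there.
\<close>

primrec iter_in_C ::
    "real \<Rightarrow> real \<Rightarrow> ((real \<Rightarrow> real) \<Rightarrow> real \<Rightarrow> real option) \<Rightarrow> nat \<Rightarrow> (real \<Rightarrow> real) \<Rightarrow> bool"
where
  "iter_in_C a b D 0 f \<longleftrightarrow> continuous_on {a..b} f"
| "iter_in_C a b D (Suc j) f \<longleftrightarrow> (\<exists>h. continuous_version a b (D (iter_op a b D j f)) h)"

text \<open>
  Definedness of the \<open>j\<close>-th iterate: all previous ones lie in \<open>AC[a,b]\<close>.  Since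
  \<open>AC[a,b] \<subseteq> C[a,b]\<close>, this means that they have continuous versions and that these versions
  are absolutely continuous.
\<close>

definition iter_defined ::
    "real \<Rightarrow> real \<Rightarrow> ((real \<Rightarrow> real) \<Rightarrow> real \<Rightarrow> real option) \<Rightarrow> nat \<Rightarrow> (real \<Rightarrow> real) \<Rightarrow> bool"
where
  "iter_defined a b D j f \<longleftrightarrow>
     (\<forall>i<j. iter_in_C a b D i f \<and> abs_cont_on a b (iter_op a b D i f))"

definition caputo_left_iter ::
    "real \<Rightarrow> real \<Rightarrow> real \<Rightarrow> real \<Rightarrow> nat \<Rightarrow> (real \<Rightarrow> real) \<Rightarrow> real \<Rightarrow> real" where
  "caputo_left_iter \<alpha> \<rho> a b = iter_op a b (caputo_left \<alpha> \<rho> a)"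

definition caputo_right_iter ::
    "real \<Rightarrow> real \<Rightarrow> real \<Rightarrow> real \<Rightarrow> nat \<Rightarrow> (real \<Rightarrow> real) \<Rightarrow> real \<Rightarrow> real" where
  "caputo_right_iter \<alpha> \<rho> a b = iter_op a b (caputo_right \<alpha> \<rho> b)"

end

theory Submission
  imports Defs
begin

text \<open>
  The substitution \<open>s = (x powr \<rho> - a powr \<rho>) / \<rho>\<close>, respectively \<open>s = (b powr \<rho> - x powr \<rho>) / \<rho>\<close>,
  turns all operators into Riemann--Liouville integrals \<open>J \<beta>\<close> on an interval \<open>[0, L]\<close>.  If \<open>k\<close> is
  absolutely continuous, so is \<open>J (1 - \<alpha>) (k - k 0)\<close>; if moreover its derivative is almost everywhere equal
  to a continuous \<open>h\<close>, then \<open>J (1 - \<alpha>) (k - k 0) = J 1 h = J (1 - \<alpha>) (J \<alpha> h)\<close>, and injectivity of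
  \<open>J (1 - \<alpha>)\<close> gives \<open>k = k 0 + J \<alpha> h\<close>.  Iterating this with the semigroup law gives the Taylor expansion
  with remainder \<open>J ((m + 1) \<alpha>)\<close> of the last derivative, to which the mean value theorem for integrals
  with a positive kernel applies.
\<close>

subsection \<open>Absolutely continuous functions\<close>

text \<open>The hypotheses prescribe the derivative of \<open>J (1 - \<alpha>) (k - k 0)\<close>
  only almost everywhere. Such information determines a function up to a constant only under
  absolute continuity: the Cantor function has derivative 0 almost everywhere. Hence absolute
  continuity must survive both the fractional integral and the change of variables. The latter is
  delicate for \<open>a = 0\<close>, because the inverse substitution involves
  \<open>y powr (1 / \<rho>)\<close> down to \<open>y = 0\<close>, which is not Lipschitz there when
  \<rho> > 1; monotonicity of the substitution takes the place of a Lipschitz bound. All functions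
  fed into \<open>J\<close> are continuous, so the semigroup law can be checked on monomials and
  carried over by uniform approximation, without exchanging the order of integration.\<close>

definition interval_family :: "real \<Rightarrow> real \<Rightarrow> 'i set \<Rightarrow> ('i \<Rightarrow> real) \<Rightarrow> ('i \<Rightarrow> real) \<Rightarrow> bool" where
  "interval_family a b P u v \<longleftrightarrow> finite P \<and> (\<forall>i\<in>P. a \<le> u i \<and> u i \<le> v i \<and> v i \<le> b) \<and>
     (\<forall>i\<in>P. \<forall>j\<in>P. i \<noteq> j \<longrightarrow> {u i<..<v i} \<inter> {u j<..<v j} = {})"

lemma abs_cont_on_iff:
  "abs_cont_on a b g \<longleftrightarrow> (\<forall>\<epsilon>>0. \<exists>\<delta>>0. \<forall>(n::nat) u v. interval_family a b {..<n} u v \<longrightarrow>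
     (\<Sum>i<n. v i - u i) < \<delta> \<longrightarrow> (\<Sum>i<n. \<bar>g (v i) - g (u i)\<bar>) < \<epsilon>)"
  unfolding abs_cont_on_def interval_family_def by (simp add: Ball_def imp_conjL)

lemma abs_cont_onI:
  assumes "\<And>\<epsilon>. \<epsilon> > 0 \<Longrightarrow> \<exists>\<delta>>0. \<forall>(n::nat) u v. interval_family a b {..<n} u v \<longrightarrow>
     (\<Sum>i<n. v i - u i) < \<delta> \<longrightarrow> (\<Sum>i<n. \<bar>g (v i) - g (u i)\<bar>) < \<epsilon>"
  shows "abs_cont_on a b g"
  unfolding abs_cont_on_iff using assms by blast

text \<open>Enumerating a finite index set reduces it to an initial segment of the naturals.
  Arbitrary index types are wanted because the fundamental theorem below applies the criterion to
  families indexed by tagged intervals.\<close>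

lemma abs_cont_onE:
  assumes "abs_cont_on a b g" "\<epsilon> > 0"
  obtains \<delta> where "\<delta> > 0"
    and "\<forall>P (u :: 'i \<Rightarrow> real) v. interval_family a b P u v \<longrightarrow>
      (\<Sum>i\<in>P. v i - u i) < \<delta> \<longrightarrow> (\<Sum>i\<in>P. \<bar>g (v i) - g (u i)\<bar>) < \<epsilon>"
proof -
  obtain \<delta> where \<delta>: "\<delta> > 0" and 1: "\<forall>(n::nat) u v. interval_family a b {..<n} u v \<longrightarrow>
     (\<Sum>i<n. v i - u i) < \<delta> \<longrightarrow> (\<Sum>i<n. \<bar>g (v i) - g (u i)\<bar>) < \<epsilon>"
    using assms unfolding abs_cont_on_iff by blast
  show thesis
  proof (rule that[OF \<delta>], intro allI impI)
    fix P :: "'i set" and u v :: "'i \<Rightarrow> real"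
    assume P: "interval_family a b P u v" "(\<Sum>i\<in>P. v i - u i) < \<delta>"
    then have "finite P" by (simp add: interval_family_def)
    then obtain h where h: "bij_betw h {..<card P} P"
      using ex_bij_betw_nat_finite[of P] by (auto simp: atLeast0LessThan)
    have hP: "h i \<in> P" if "i < card P" for i
      using h that by (auto simp: bij_betw_def)
    have hn: "h i \<noteq> h j" if "i < card P" "j < card P" "i \<noteq> j" for i j
      using h that by (auto simp: bij_betw_def inj_on_def)
    have "interval_family a b {..<card P} (u \<circ> h) (v \<circ> h)"
      using P(1) hP hn by (auto simp: interval_family_def)
    moreover have "(\<Sum>i<card P. (v \<circ> h) i - (u \<circ> h) i) < \<delta>"
      using P(2) sum.reindex_bij_betw[OF h, of "\<lambda>i. v i - u i"] by simp
    ultimately have "(\<Sum>i<card P. \<bar>g ((v \<circ> h) i) - g ((u \<circ> h) i)\<bar>) < \<epsilon>"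
      using 1 by blast
    then show "(\<Sum>i\<in>P. \<bar>g (v i) - g (u i)\<bar>) < \<epsilon>"
      using sum.reindex_bij_betw[OF h, of "\<lambda>i. \<bar>g (v i) - g (u i)\<bar>"] by simp
  qed
qed

text \<open>By disjointness the total length is the measure of the union. It is applied to intervals
  caught in a small open set and to the image intervals of a bounded monotone function.\<close>

lemma sum_length_interval_family_le:
  assumes P: "interval_family a b P u v" and sub: "\<And>i. i \<in> P \<Longrightarrow> {u i<..<v i} \<subseteq> T"
    and T: "T \<in> lmeasurable"
  shows "(\<Sum>i\<in>P. v i - u i) \<le> measure lebesgue T"
proof -
  have P': "finite P" "\<And>i. i \<in> P \<Longrightarrow> u i \<le> v i"
    "\<And>i j. i \<in> P \<Longrightarrow> j \<in> P \<Longrightarrow> i \<noteq> j \<Longrightarrow> {u i<..<v i} \<inter> {u j<..<v j} = {}"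
    using P by (auto simp: interval_family_def)
  have "(\<Sum>i\<in>P. v i - u i) = (\<Sum>i\<in>P. measure lebesgue {u i<..<v i})"
    using P'(2) by (intro sum.cong) auto
  also have "\<dots> = measure lebesgue (\<Union>i\<in>P. {u i<..<v i})"
    by (rule measure_UNION'[symmetric]) (use P' in \<open>auto simp: pairwise_def disjnt_def\<close>)
  also have "\<dots> \<le> measure lebesgue T"
    by (rule measure_mono_fmeasurable) (use sub T P' in \<open>auto intro!: sets.finite_UN\<close>)
  finally show ?thesis .
qed

lemma abs_cont_on_imp_continuous_on:
  assumes "abs_cont_on a b g"
  shows "continuous_on {a..b} g"
proof (rule continuous_on_iff[THEN iffD2], intro ballI allI impI)
  fix x \<epsilon> :: real assume x: "x \<in> {a..b}" and "\<epsilon> > 0"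
  obtain \<delta> where \<delta>: "\<delta> > 0" and 1: "\<forall>(P :: nat set) u v. interval_family a b P u v \<longrightarrow>
      (\<Sum>i\<in>P. v i - u i) < \<delta> \<longrightarrow> (\<Sum>i\<in>P. \<bar>g (v i) - g (u i)\<bar>) < \<epsilon>"
    by (rule abs_cont_onE[OF assms \<open>\<epsilon> > 0\<close>])
  have "dist (g y) (g x) < \<epsilon>" if "y \<in> {a..b}" "dist y x < \<delta>" for y
    using 1[rule_format, of "{0}" "\<lambda>_. min x y" "\<lambda>_. max x y"] that x
    by (cases "x \<le> y") (auto simp: interval_family_def dist_real_def abs_minus_commute)
  then show "\<exists>d>0. \<forall>x'\<in>{a..b}. dist x' x < d \<longrightarrow> dist (g x') (g x) < \<epsilon>"
    using \<delta> by blast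
qed

lemma abs_cont_on_subinterval:
  assumes "abs_cont_on a b g" "a \<le> c" "d \<le> b"
  shows "abs_cont_on c d g"
proof (rule abs_cont_onI)
  have "interval_family a b P u v" if "interval_family c d P u v" for P :: "nat set" and u v
    using that assms(2,3) unfolding interval_family_def by force
  moreover fix \<epsilon> :: real assume "\<epsilon> > 0"
  ultimately show "\<exists>\<delta>>0. \<forall>(n::nat) u v. interval_family c d {..<n} u v \<longrightarrow>
     (\<Sum>i<n. v i - u i) < \<delta> \<longrightarrow> (\<Sum>i<n. \<bar>g (v i) - g (u i)\<bar>) < \<epsilon>"
    using assms(1) unfolding abs_cont_on_iff by meson
qed

text \<open>Intervals with disjoint interiors are ordered on the line, and a monotone map keeps or
  reverses that order. Taking \<open>min\<close> and \<open>max\<close> of the image endpoints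
  treats increasing and decreasing maps alike; the right-sided coordinate is decreasing.\<close>

lemma interval_family_monotone_image:
  assumes P: "interval_family c d P u v" and \<psi>: "\<psi> ` {c..d} \<subseteq> {a..b}"
    and mono: "mono_on {c..d} \<psi> \<or> antimono_on {c..d} \<psi>"
  shows "interval_family a b P (\<lambda>i. min (\<psi> (u i)) (\<psi> (v i))) (\<lambda>i. max (\<psi> (u i)) (\<psi> (v i)))"
proof -
  define u' v' where "u' = (\<lambda>i. min (\<psi> (u i)) (\<psi> (v i)))" and "v' = (\<lambda>i. max (\<psi> (u i)) (\<psi> (v i)))"
  have uv: "c \<le> u i" "u i \<le> v i" "v i \<le> d" if "i \<in> P" for i
    using P that by (auto simp: interval_family_def)
  have "{u' i<..<v' i} \<inter> {u' j<..<v' j} = {}" if ij: "i \<in> P" "j \<in> P" "i \<noteq> j" for i j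
  proof -
    \<comment> \<open>The last two cases are needed because a degenerate interval has empty interior
      and may therefore lie inside another member of the family.\<close>
    have "v i \<le> u j \<or> v j \<le> u i \<or> u i = v i \<or> u j = v j"
    proof (rule ccontr)
      assume "\<not> ?thesis"
      then have "max (u i) (u j) < min (v i) (v j)"
        using uv[of i] uv[of j] ij by (auto simp: less_le)
      then obtain z where "max (u i) (u j) < z" "z < min (v i) (v j)" using dense by blast
      then have "z \<in> {u i<..<v i} \<inter> {u j<..<v j}" by auto
      then show False using P ij unfolding interval_family_def by blast
    qed
    moreover have M: "\<psi> p \<le> \<psi> q \<and> \<psi> q \<le> \<psi> r \<and> \<psi> r \<le> \<psi> s \<or> \<psi> p \<ge> \<psi> q \<and> \<psi> q \<ge> \<psi> r \<and> \<psi> r \<ge> \<psi> s"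
      if "c \<le> p" "p \<le> q" "q \<le> r" "r \<le> s" "s \<le> d" for p q r s
      using mono that by (auto simp: monotone_on_def)
    moreover have "{u' i<..<v' i} = {}" if "u i = v i" for i
      using that by (simp add: u'_def v'_def)
    moreover have "u' i \<ge> v' j \<or> u' j \<ge> v' i" if "v i \<le> u j"
      using M[of "u i" "v i" "u j" "v j"] uv[of i] uv[of j] that ij by (auto simp: u'_def v'_def)
    moreover have "u' i \<ge> v' j \<or> u' j \<ge> v' i" if "v j \<le> u i"
      using M[of "u j" "v j" "u i" "v i"] uv[of i] uv[of j] that ij by (auto simp: u'_def v'_def)
    ultimately consider "{u' i<..<v' i} = {}" | "{u' j<..<v' j} = {}" | "u' i \<ge> v' j" | "u' j \<ge> v' i"
      by blast
    then show ?thesis by cases auto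
  qed
  moreover have "a \<le> u' i \<and> u' i \<le> v' i \<and> v' i \<le> b" if "i \<in> P" for i
  proof -
    have "\<psi> (u i) \<in> {a..b}" "\<psi> (v i) \<in> {a..b}" using uv[OF that] by (intro \<psi>[THEN subsetD] imageI; simp)+
    then show ?thesis by (auto simp: u'_def v'_def)
  qed
  ultimately have "interval_family a b P u' v'"
    using P by (simp add: interval_family_def)
  then show ?thesis unfolding u'_def v'_def .
qed

text \<open>A composition of absolutely continuous functions need not be absolutely continuous. A
  monotone inner map sends a family of non-overlapping intervals to another such family, so the
  \<delta> of the outer function can serve as the \<epsilon> of the inner one.\<close>

lemma abs_cont_on_compose_monotone:
  assumes "abs_cont_on a b g" "abs_cont_on c d \<psi>" "\<psi> ` {c..d} \<subseteq> {a..b}"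
    and mono: "mono_on {c..d} \<psi> \<or> antimono_on {c..d} \<psi>"
  shows "abs_cont_on c d (\<lambda>t. g (\<psi> t))"
proof (rule abs_cont_onI)
  fix \<epsilon> :: real assume "\<epsilon> > 0"
  obtain \<delta> where "\<delta> > 0" and 1: "\<forall>(P :: nat set) u v. interval_family a b P u v \<longrightarrow>
      (\<Sum>i\<in>P. v i - u i) < \<delta> \<longrightarrow> (\<Sum>i\<in>P. \<bar>g (v i) - g (u i)\<bar>) < \<epsilon>"
    by (rule abs_cont_onE[OF assms(1) \<open>\<epsilon> > 0\<close>])
  obtain \<eta> where "\<eta> > 0" and 2: "\<forall>(P :: nat set) u v. interval_family c d P u v \<longrightarrow>
      (\<Sum>i\<in>P. v i - u i) < \<eta> \<longrightarrow> (\<Sum>i\<in>P. \<bar>\<psi> (v i) - \<psi> (u i)\<bar>) < \<delta>"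
    by (rule abs_cont_onE[OF assms(2) \<open>\<delta> > 0\<close>])
  have "(\<Sum>i<n. \<bar>g (\<psi> (v i)) - g (\<psi> (u i))\<bar>) < \<epsilon>"
    if uv: "interval_family c d {..<n} u v" and len: "(\<Sum>i<n. v i - u i) < \<eta>" for n :: nat and u v
  proof -
    define u' v' where "u' = (\<lambda>i. min (\<psi> (u i)) (\<psi> (v i)))" and "v' = (\<lambda>i. max (\<psi> (u i)) (\<psi> (v i)))"
    have "(\<Sum>i<n. v' i - u' i) = (\<Sum>i<n. \<bar>\<psi> (v i) - \<psi> (u i)\<bar>)"
      by (intro sum.cong) (auto simp: u'_def v'_def)
    then have "(\<Sum>i<n. v' i - u' i) < \<delta>" using 2[rule_format, OF uv len] by simp
    moreover have "interval_family a b {..<n} u' v'"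
      using interval_family_monotone_image[OF uv assms(3) mono] unfolding u'_def v'_def .
    ultimately have "(\<Sum>i<n. \<bar>g (v' i) - g (u' i)\<bar>) < \<epsilon>"
      by (intro 1[rule_format])
    moreover have "(\<Sum>i<n. \<bar>g (v' i) - g (u' i)\<bar>) = (\<Sum>i<n. \<bar>g (\<psi> (v i)) - g (\<psi> (u i))\<bar>)"
      by (intro sum.cong) (auto simp: u'_def v'_def min_def max_def)
    ultimately show ?thesis by simp
  qed
  then show "\<exists>\<delta>>0. \<forall>(n::nat) u v. interval_family c d {..<n} u v \<longrightarrow>
        (\<Sum>i<n. v i - u i) < \<delta> \<longrightarrow> (\<Sum>i<n. \<bar>g (\<psi> (v i)) - g (\<psi> (u i))\<bar>) < \<epsilon>"
    using \<open>\<eta> > 0\<close> by blast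
qed

lemma sum_increments_Lipschitz_le:
  assumes P: "interval_family a b P u v"
    and K: "\<And>s t. a \<le> s \<Longrightarrow> s \<le> t \<Longrightarrow> t \<le> b \<Longrightarrow> \<bar>g t - g s\<bar> \<le> K * (t - s)"
  shows "(\<Sum>i\<in>P. \<bar>g (v i) - g (u i)\<bar>) \<le> K * (\<Sum>i\<in>P. v i - u i)"
  unfolding sum_distrib_left using P by (intro sum_mono K) (auto simp: interval_family_def)

lemma abs_cont_on_Lipschitz:
  assumes "\<And>s t. a \<le> s \<Longrightarrow> s \<le> t \<Longrightarrow> t \<le> b \<Longrightarrow> \<bar>g t - g s\<bar> \<le> K * (t - s)"
  shows "abs_cont_on a b g"
proof (rule abs_cont_onI)
  fix \<epsilon> :: real assume "\<epsilon> > 0"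
  have K1: "\<bar>K\<bar> + 1 > 0" by linarith
  have "(\<Sum>i<n. \<bar>g (v i) - g (u i)\<bar>) < \<epsilon>"
    if uv: "interval_family a b {..<n} u v" and len: "(\<Sum>i<n. v i - u i) < \<epsilon> / (\<bar>K\<bar> + 1)"
    for n :: nat and u v
  proof -
    have "\<bar>g t - g s\<bar> \<le> (\<bar>K\<bar> + 1) * (t - s)" if "a \<le> s" "s \<le> t" "t \<le> b" for s t
      using assms[OF that] mult_right_mono[of K "\<bar>K\<bar> + 1" "t - s"] that by linarith
    then have "(\<Sum>i<n. \<bar>g (v i) - g (u i)\<bar>) \<le> (\<bar>K\<bar> + 1) * (\<Sum>i<n. v i - u i)"
      by (rule sum_increments_Lipschitz_le[OF uv])
    also have "\<dots> < \<epsilon>" using len K1 by (simp add: pos_less_divide_eq mult.commute)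
    finally show ?thesis .
  qed
  then show "\<exists>\<delta>>0. \<forall>(n::nat) u v. interval_family a b {..<n} u v \<longrightarrow>
        (\<Sum>i<n. v i - u i) < \<delta> \<longrightarrow> (\<Sum>i<n. \<bar>g (v i) - g (u i)\<bar>) < \<epsilon>"
    by (intro exI[of _ "\<epsilon> / (\<bar>K\<bar> + 1)"]) (use \<open>\<epsilon> > 0\<close> K1 in auto)
qed

text \<open>The gauge integral gives a direct proof. Tags outside the exceptional set are handled by
  the linear approximation of \<open>F\<close> at the tag; intervals tagged inside it are forced
  into an open set of small measure, where absolute continuity makes the sum of the increments of
  \<open>F\<close> small.\<close>

theorem fundamental_theorem_of_calculus_abs_cont:
  assumes AC: "abs_cont_on a b F" and "a \<le> b" and N: "negligible N"
    and deriv: "\<And>x. x \<in> {a<..<b} - N \<Longrightarrow> (F has_real_derivative k x) (at x)"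
  shows "(k has_integral (F b - F a)) {a..b}"
proof (cases "a = b")
  case True
  then show ?thesis by auto
next
  case False
  with \<open>a \<le> b\<close> have "a < b" by simp
  \<comment> \<open>The end points join the exceptional set because the derivative is known only in
    the open interval. Setting the integrand to 0 on \<open>N'\<close> leaves just the increments of
    \<open>F\<close> at exceptional tags.\<close>
  define N' where "N' = N \<union> {a, b}"
  define k' where "k' x = (if x \<in> N' then 0 else k x)" for x
  have N': "negligible N'"
    using N by (simp add: N'_def insert_def[symmetric])
  have "(k' has_integral (F b - F a)) {a..b}"
    unfolding has_integral_factor_content_real
  proof (intro allI impI)
    fix e :: real assume "e > 0"
    \<comment> \<open>The admissible error is \<open>e * (b - a)\<close>; one half is reserved for
      the exceptional tags, the other for the remaining ones.\<close>
    then have "e / 2 * (b - a) > 0" using \<open>a < b\<close> by simp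
    obtain \<delta> where "\<delta> > 0" and \<delta>: "\<forall>P (u :: real \<times> real set \<Rightarrow> real) v. interval_family a b P u v \<longrightarrow>
      (\<Sum>i\<in>P. v i - u i) < \<delta> \<longrightarrow> (\<Sum>i\<in>P. \<bar>F (v i) - F (u i)\<bar>) < e / 2 * (b - a)"
      by (rule abs_cont_onE[OF AC \<open>e / 2 * (b - a) > 0\<close>])
    have N'_leb: "N' \<in> sets lebesgue" using N' by (simp add: negligible_iff_null_sets null_setsD2)
    obtain U where U: "open U" "N' \<subseteq> U" "U - N' \<in> lmeasurable" "emeasure lebesgue (U - N') < ennreal \<delta>"
      using sets_lebesgue_outer_open[OF N'_leb \<open>\<delta> > 0\<close>] by blast
    have "U = (U - N') \<union> N'" using U(2) by blast
    then have Um: "U \<in> lmeasurable"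
      using fmeasurable.Un[OF U(3) negligible_imp_measurable[OF N']] by simp
    have "measure lebesgue U = measure lebesgue (U - N')"
      using measure_Diff_null_set[of U lebesgue N'] N' Um by (simp add: negligible_iff_null_sets fmeasurableD)
    then have Ud: "measure lebesgue U < \<delta>"
      using U(3,4) \<open>\<delta> > 0\<close> by (simp add: emeasure_eq_measure2 ennreal_less_iff)
    have "\<exists>d>0. x \<in> {a..b} - N' \<longrightarrow>
       (\<forall>y. \<bar>y - x\<bar> < d \<longrightarrow> \<bar>F y - F x - (y - x) * k x\<bar> \<le> e / 2 * \<bar>y - x\<bar>)" for x
    proof (cases "x \<in> {a..b} - N'")
      case True
      then have "x \<in> {a<..<b} - N" by (auto simp: N'_def less_le)
      then have "(F has_derivative (\<lambda>h. h * k x)) (at x)"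
        using deriv by (simp add: has_field_derivative_def mult_commute_abs)
      then have "\<forall>\<epsilon>>0. \<exists>d>0. \<forall>y. norm (y - x) < d \<longrightarrow>
          norm (F y - F x - (y - x) * k x) \<le> \<epsilon> * norm (y - x)"
        unfolding has_derivative_at_alt by blast
      from this[rule_format, of "e / 2"] \<open>e > 0\<close> show ?thesis by auto
    qed (auto intro: exI[of _ 1])
    then obtain d where d: "\<And>x. d x > 0" and straddle: "\<And>x y. x \<in> {a..b} - N' \<Longrightarrow> \<bar>y - x\<bar> < d x \<Longrightarrow>
       \<bar>F y - F x - (y - x) * k x\<bar> \<le> e / 2 * \<bar>y - x\<bar>"
      by metis
    \<comment> \<open>At an exceptional tag the gauge is all of \<open>U\<close>, so the intervals
      with such tags lie in \<open>U\<close> and have total length below \<delta>, however many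
      there are.\<close>
    define \<gamma> where "\<gamma> x = (if x \<in> N' then U else ball x (d x))" for x
    have gauge: "gauge \<gamma>" using U(1,2) d by (auto simp: gauge_def \<gamma>_def)
    have fine_le: "norm ((\<Sum>(x, K)\<in>p. measure lborel K *\<^sub>R k' x) - (F b - F a)) \<le> e * measure lborel {a..b}"
      if ptag: "p tagged_division_of {a..b}" and fine: "\<gamma> fine p" for p
    proof -
      define u v where "u q = Inf (snd q)" and "v q = Sup (snd q)" for q :: "real \<times> real set"
      have K: "snd q = {u q..v q}" "u q \<le> v q" "a \<le> u q" "v q \<le> b" "fst q \<in> {u q..v q}" if "q \<in> p" for q
      proof -
        obtain x K where q: "q = (x, K)" by force
        obtain c e where "K = cbox c e" using tagged_division_ofD(4)[OF ptag] \<open>q \<in> p\<close> unfolding q by blast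
        moreover have "x \<in> K" "K \<subseteq> {a..b}" using tagged_division_ofD(2,3)[OF ptag] that unfolding q by blast+
        ultimately show "snd q = {u q..v q}" "u q \<le> v q" "a \<le> u q" "v q \<le> b" "fst q \<in> {u q..v q}"
          by (auto simp: u_def v_def q)
      qed
      define B where "B = {q \<in> p. fst q \<in> N'}"
      have finp: "finite p" using ptag by blast
      have fam: "interval_family a b B u v"
        unfolding interval_family_def
      proof (intro conjI ballI impI)
        fix i j assume ij: "i \<in> B" "j \<in> B" "i \<noteq> j"
        have "interior (snd i) \<inter> interior (snd j) = {}"
          using tagged_division_ofD(5)[OF ptag, of "fst i" "snd i" "fst j" "snd j"] ij by (simp add: B_def)
        then show "{u i<..<v i} \<inter> {u j<..<v j} = {}"
          using K(1)[of i] K(1)[of j] ij by (simp add: B_def)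
      qed (use finp K in \<open>auto simp: B_def\<close>)
      have "(\<Sum>q\<in>B. v q - u q) \<le> measure lebesgue U"
      proof (rule sum_length_interval_family_le[OF fam _ Um])
        fix q assume "q \<in> B"
        then have "snd q \<subseteq> U" using fineD[OF fine, of "fst q" "snd q"] by (simp add: B_def \<gamma>_def)
        then show "{u q<..<v q} \<subseteq> U" using K(1)[of q] \<open>q \<in> B\<close> by (auto simp: B_def)
      qed
      then have bad: "(\<Sum>q\<in>B. \<bar>F (v q) - F (u q)\<bar>) < e / 2 * (b - a)"
        using \<delta>[rule_format, OF fam] Ud by simp
      have term_le: "\<bar>(v q - u q) * k' (fst q) - (F (v q) - F (u q))\<bar>
          \<le> (if q \<in> B then \<bar>F (v q) - F (u q)\<bar> else 0) + e / 2 * (v q - u q)" if "q \<in> p" for q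
      proof (cases "q \<in> B")
        case True
        then show ?thesis using K(2)[OF that] \<open>e > 0\<close> by (simp add: k'_def B_def abs_minus_commute)
      next
        case False
        let ?x = "fst q"
        have x: "?x \<in> {a..b} - N'" using False that K[OF that] by (auto simp: B_def)
        have "snd q \<subseteq> ball ?x (d ?x)"
          using fineD[OF fine, of "fst q" "snd q"] that x by (simp add: \<gamma>_def)
        moreover have "u q \<in> snd q" "v q \<in> snd q" using K(1,2)[OF that] by simp_all
        ultimately have "u q \<in> ball ?x (d ?x)" "v q \<in> ball ?x (d ?x)" by blast+
        then have near: "\<bar>F (u q) - F ?x - (u q - ?x) * k ?x\<bar> \<le> e / 2 * \<bar>u q - ?x\<bar>"
          "\<bar>F (v q) - F ?x - (v q - ?x) * k ?x\<bar> \<le> e / 2 * \<bar>v q - ?x\<bar>"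
          by (intro straddle[OF x]; simp add: dist_real_def abs_minus_commute)+
        \<comment> \<open>Both end points are compared with the value at the tag, which cancels.
          Since the tag lies between them, the two errors add up to \<open>e / 2\<close> times the
          length of the interval.\<close>
        have "\<bar>p' - p - (y' - y)\<bar> \<le> A + A'"
          if "\<bar>y - z - p\<bar> \<le> A" "\<bar>y' - z - p'\<bar> \<le> A'" for p p' y y' z A A' :: real
          using that by linarith
        from this[OF near] have "\<bar>(v q - ?x) * k ?x - (u q - ?x) * k ?x - (F (v q) - F (u q))\<bar>
            \<le> e / 2 * \<bar>u q - ?x\<bar> + e / 2 * \<bar>v q - ?x\<bar>" .
        also have "\<dots> = e / 2 * (v q - u q)"
          using K(5)[OF that] by (simp add: field_simps)
        finally have "\<bar>(v q - u q) * k ?x - (F (v q) - F (u q))\<bar> \<le> e / 2 * (v q - u q)"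
          by (simp add: algebra_simps)
        then show ?thesis using False x by (simp add: k'_def)
      qed
      \<comment> \<open>This telescoping identity is used twice: with \<open>F\<close> for the
        increments and with \<open>id\<close> for the lengths.\<close>
      have tot: "(\<Sum>q\<in>p. H (v q) - H (u q)) = H b - H a" for H :: "real \<Rightarrow> real"
        using additive_tagged_division_1[OF \<open>a \<le> b\<close> ptag, of H] by (simp add: u_def v_def split_def)
      have "(\<Sum>(x, K)\<in>p. measure lborel K *\<^sub>R k' x) = (\<Sum>q\<in>p. (v q - u q) * k' (fst q))"
        using K by (intro sum.cong) (auto simp: split_def)
      then have "norm ((\<Sum>(x, K)\<in>p. measure lborel K *\<^sub>R k' x) - (F b - F a))
          = \<bar>\<Sum>q\<in>p. (v q - u q) * k' (fst q) - (F (v q) - F (u q))\<bar>"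
        using tot[of F] by (simp add: sum_subtractf)
      also have "\<dots> \<le> (\<Sum>q\<in>p. \<bar>(v q - u q) * k' (fst q) - (F (v q) - F (u q))\<bar>)" by (rule sum_abs)
      also have "\<dots> \<le> (\<Sum>q\<in>p. (if q \<in> B then \<bar>F (v q) - F (u q)\<bar> else 0) + e / 2 * (v q - u q))"
        by (rule sum_mono) (rule term_le)
      also have "\<dots> = (\<Sum>q\<in>p. if q \<in> B then \<bar>F (v q) - F (u q)\<bar> else 0) + e / 2 * (b - a)"
        using tot[of id] by (simp only: sum.distrib sum_distrib_left[symmetric] id_apply)
      also have "(\<Sum>q\<in>p. if q \<in> B then \<bar>F (v q) - F (u q)\<bar> else 0) = (\<Sum>q\<in>B. \<bar>F (v q) - F (u q)\<bar>)"
        using finp by (simp add: sum.If_cases B_def Int_def)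
      finally show ?thesis using bad \<open>a < b\<close> by simp
    qed
    show "\<exists>d. gauge d \<and> (\<forall>p. p tagged_division_of {a..b} \<and> d fine p \<longrightarrow>
      norm ((\<Sum>(x, K)\<in>p. measure lborel K *\<^sub>R k' x) - (F b - F a)) \<le> e * measure lborel {a..b})"
      by (intro exI[of _ \<gamma>] conjI gauge allI impI, elim conjE, rule fine_le)
  qed
  then show ?thesis
    by (rule has_integral_spike[OF N', rotated]) (simp add: k'_def)
qed

text \<open>The function \<open>y powr p\<close> splits at \<open>\<eta>\<close> into a part of total variation \<open>\<eta> powr p\<close> and a Lipschitz part.\<close>

lemma abs_cont_on_powr:
  fixes p :: real
  assumes "p > 0" "0 \<le> a"
  shows "abs_cont_on a b (\<lambda>y. y powr p)"
proof (rule abs_cont_onI)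
  fix \<epsilon> :: real assume "\<epsilon> > 0"
  define \<eta> where "\<eta> = (\<epsilon> / 2) powr (1 / p)"
  have \<eta>: "\<eta> > 0" "\<eta> powr p = \<epsilon> / 2"
    using \<open>\<epsilon> > 0\<close> \<open>p > 0\<close> by (auto simp: \<eta>_def powr_powr)
  define b' where "b' = max b \<eta>"
  \<comment> \<open>The derivative \<open>p * z powr (p - 1)\<close> is monotone in
    \<open>z\<close>, so on the range from \<open>\<eta>\<close> to \<open>b'\<close> it is bounded
    by its value at one of the ends; which one depends on whether \<open>p \<ge> 1\<close>. The
    maximum in \<open>b'\<close> covers the case \<open>\<eta> > b\<close>.\<close>
  define K where "K = p * max (\<eta> powr (p - 1)) (b' powr (p - 1))"
  have K: "K > 0" using \<eta>(1) \<open>p > 0\<close> by (simp add: K_def less_max_iff_disj)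
  have lip: "\<bar>max t \<eta> powr p - max s \<eta> powr p\<bar> \<le> K * (t - s)" if "s \<le> t" "t \<le> b" for s t
  proof (cases "t \<le> \<eta>")
    case True
    then show ?thesis using that K by (simp add: max_def)
  next
    case False
    define s' where "s' = max s \<eta>"
    have s': "s' \<le> t" "\<eta> \<le> s'" "s \<le> s'" using False that by (auto simp: s'_def)
    have "norm (t powr p - s' powr p) \<le> K * norm (t - s')"
    proof (rule field_differentiable_bound[of "{s'..t}"])
      fix z assume z: "z \<in> {s'..t}"
      then have "z > 0" using s' \<eta> by auto
      show "((\<lambda>z. z powr p) has_field_derivative p * z powr (p - 1)) (at z within {s'..t})"
        using \<open>z > 0\<close> by (auto intro!: derivative_eq_intros)
      have "z powr (p - 1) \<le> max (\<eta> powr (p - 1)) (b' powr (p - 1))"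
      proof (cases "p \<ge> 1")
        case True
        then have "z powr (p - 1) \<le> b' powr (p - 1)" 
          using z that \<open>z > 0\<close> by (intro powr_mono2) (auto simp: b'_def)
        then show ?thesis by simp
      next
        case False
        then have "z powr (p - 1) \<le> \<eta> powr (p - 1)" using z s' \<eta> by (intro powr_mono2') auto
        then show ?thesis by simp
      qed
      then show "norm (p * z powr (p - 1)) \<le> K" using \<open>p > 0\<close> \<open>z > 0\<close> by (simp add: K_def)
    qed (use s' in auto)
    then have "\<bar>t powr p - s' powr p\<bar> \<le> K * (t - s')" using s' by simp
    also have "\<dots> \<le> K * (t - s)" using K s' by simp
    finally show ?thesis using False by (simp add: s'_def)
  qed
  have split: "y powr p = min y \<eta> powr p + max y \<eta> powr p - \<eta> powr p" for y
    by (simp add: min_def max_def)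
  have "(\<Sum>i<n. \<bar>v i powr p - u i powr p\<bar>) < \<epsilon>"
    if uv: "interval_family a b {..<n} u v" and len: "(\<Sum>i<n. v i - u i) < \<epsilon> / 2 / K"
    for n :: nat and u v
  proof -
    have abs_eq: "\<bar>x - y\<bar> = max y x - min y x" for x y :: real by auto
    have mono: "mono_on {a..b} (\<lambda>y. min y \<eta> powr p)"
      using \<open>0 \<le> a\<close> \<open>p > 0\<close> \<eta> by (intro mono_onI powr_mono2) auto
    have img: "(\<lambda>y. min y \<eta> powr p) ` {a..b} \<subseteq> {0..\<epsilon> / 2}"
    proof safe
      fix y assume "y \<in> {a..b}"
      then have "min y \<eta> powr p \<le> \<eta> powr p" using \<open>0 \<le> a\<close> \<open>p > 0\<close> \<eta> by (intro powr_mono2) auto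
      then show "min y \<eta> powr p \<in> {0..\<epsilon> / 2}" using \<eta> by simp
    qed
    \<comment> \<open>The values of the increasing lower part lie in
      \<open>{0..\<epsilon> / 2}\<close>, so its increments over the family are lengths of
      non-overlapping intervals in there.\<close>
    note fam = interval_family_monotone_image[OF uv img disjI1[OF mono]]
    have "(\<Sum>i<n. \<bar>min (v i) \<eta> powr p - min (u i) \<eta> powr p\<bar>)
      = (\<Sum>i<n. max (min (u i) \<eta> powr p) (min (v i) \<eta> powr p)
             - min (min (u i) \<eta> powr p) (min (v i) \<eta> powr p))"
      by (simp only: abs_eq)
    also have "\<dots> \<le> measure lebesgue {0..\<epsilon> / 2}"
    proof (rule sum_length_interval_family_le[OF fam])
      fix i assume "i \<in> {..<n}"
      then have "0 \<le> min (min (u i) \<eta> powr p) (min (v i) \<eta> powr p)"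
        "max (min (u i) \<eta> powr p) (min (v i) \<eta> powr p) \<le> \<epsilon> / 2"
        using fam unfolding interval_family_def by blast+
      then show "{min (min (u i) \<eta> powr p) (min (v i) \<eta> powr p)<..<
         max (min (u i) \<eta> powr p) (min (v i) \<eta> powr p)} \<subseteq> {0..\<epsilon> / 2}"
        unfolding subset_iff greaterThanLessThan_iff atLeastAtMost_iff by linarith
    qed simp
    also have "\<dots> = \<epsilon> / 2" using \<open>\<epsilon> > 0\<close> by simp
    finally have 1: "(\<Sum>i<n. \<bar>min (v i) \<eta> powr p - min (u i) \<eta> powr p\<bar>) \<le> \<epsilon> / 2" .
    have "(\<Sum>i<n. \<bar>max (v i) \<eta> powr p - max (u i) \<eta> powr p\<bar>) \<le> K * (\<Sum>i<n. v i - u i)"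
      by (rule sum_increments_Lipschitz_le[OF uv]) (rule lip)
    also have "\<dots> < \<epsilon> / 2" using len K by (simp add: pos_less_divide_eq mult.commute)
    finally have 2: "(\<Sum>i<n. \<bar>max (v i) \<eta> powr p - max (u i) \<eta> powr p\<bar>) < \<epsilon> / 2" .
    have "(\<Sum>i<n. \<bar>v i powr p - u i powr p\<bar>)
       \<le> (\<Sum>i<n. \<bar>min (v i) \<eta> powr p - min (u i) \<eta> powr p\<bar> + \<bar>max (v i) \<eta> powr p - max (u i) \<eta> powr p\<bar>)"
    proof (rule sum_mono)
      fix i
      show "\<bar>v i powr p - u i powr p\<bar>
         \<le> \<bar>min (v i) \<eta> powr p - min (u i) \<eta> powr p\<bar> + \<bar>max (v i) \<eta> powr p - max (u i) \<eta> powr p\<bar>"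
        using split[of "v i"] split[of "u i"] by linarith
    qed
    then show ?thesis using 1 2 by (simp add: sum.distrib)
  qed
  then show "\<exists>\<delta>>0. \<forall>(n::nat) u v. interval_family a b {..<n} u v \<longrightarrow>
        (\<Sum>i<n. v i - u i) < \<delta> \<longrightarrow> (\<Sum>i<n. \<bar>v i powr p - u i powr p\<bar>) < \<epsilon>"
    by (intro exI[of _ "\<epsilon> / 2 / K"]) (use \<open>\<epsilon> > 0\<close> K in auto)
qed

subsection \<open>Riemann--Liouville integrals\<close>

definition RL_int :: "real \<Rightarrow> (real \<Rightarrow> real) \<Rightarrow> real \<Rightarrow> real" where
  "RL_int \<beta> h s = integral {0..s} (\<lambda>t. (s - t) powr (\<beta> - 1) * h t) / Gamma \<beta>"

text \<open>The Beta integral on the unit interval, rescaled by the factor \<open>s\<close>.\<close>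

lemma has_integral_RL_kernel_powr:
  fixes \<beta> \<mu> s :: real
  assumes "\<beta> > 0" "\<mu> > -1" "s > 0"
  shows "((\<lambda>t. (s - t) powr (\<beta> - 1) * t powr \<mu>) has_integral
    s powr (\<beta> + \<mu>) * Beta (\<mu> + 1) \<beta>) {0..s}"
proof -
  have "((\<lambda>t. t powr (\<mu> + 1 - 1) * (1 - t) powr (\<beta> - 1)) has_integral Beta (\<mu> + 1) \<beta>) {0..1}"
    using assms by (intro has_integral_Beta_real) auto
  from has_integral_stretch_real[OF this, of "1 / s"]
  have "((\<lambda>t. (t / s) powr \<mu> * (1 - t / s) powr (\<beta> - 1)) has_integral s * Beta (\<mu> + 1) \<beta>) ((\<lambda>x. x * s) ` {0..1})"
    using \<open>s > 0\<close> by simp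
  moreover have "(\<lambda>x. x * s) ` {0..1} = {0..s}"
    using \<open>s > 0\<close> image_mult_atLeastAtMost[of s 0 1] by (simp add: mult.commute)
  ultimately have "((\<lambda>t. (t / s) powr \<mu> * (1 - t / s) powr (\<beta> - 1)) has_integral s * Beta (\<mu> + 1) \<beta>) {0..s}"
    by simp
  from has_integral_mult_right[OF this, of "s powr (\<beta> + \<mu> - 1)"]
  have "((\<lambda>t. s powr (\<beta> + \<mu> - 1) * ((t / s) powr \<mu> * (1 - t / s) powr (\<beta> - 1))) has_integral
     s powr (\<beta> + \<mu>) * Beta (\<mu> + 1) \<beta>) {0..s}"
    using \<open>s > 0\<close> by (simp add: powr_diff)
  moreover have "s powr (\<beta> + \<mu> - 1) * ((t / s) powr \<mu> * (1 - t / s) powr (\<beta> - 1))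
     = (s - t) powr (\<beta> - 1) * t powr \<mu>" if "t \<in> {0..s}" for t
  proof -
    have "1 - t / s = (s - t) / s" using \<open>s > 0\<close> by (simp add: field_simps)
    moreover have "s powr (\<beta> + \<mu> - 1) = s powr \<mu> * s powr (\<beta> - 1)"
      by (simp add: powr_add[symmetric] algebra_simps)
    ultimately show ?thesis
      using that \<open>s > 0\<close> by (simp add: powr_divide)
  qed
  ultimately show ?thesis
    using has_integral_cong by (metis (no_types, lifting))
qed

lemma has_integral_RL_kernel_power:
  fixes \<beta> s :: real
  assumes "\<beta> > 0" "s > 0"
  shows "((\<lambda>t. (s - t) powr (\<beta> - 1) * t ^ n) has_integral s powr (\<beta> + real n) * Beta (real n + 1) \<beta>) {0..s}"
\<comment> \<open>The point 0 is exceptional because \<open>0 powr 0 = 0\<close> whereas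
  \<open>0 ^ 0 = 1\<close>.\<close>
proof (rule has_integral_spike[of "{0}"])
  show "((\<lambda>t. (s - t) powr (\<beta> - 1) * t powr real n) has_integral s powr (\<beta> + real n) * Beta (real n + 1) \<beta>) {0..s}"
    using assms by (intro has_integral_RL_kernel_powr) auto
qed (auto simp: powr_realpow)

lemma has_integral_RL_kernel:
  fixes \<beta> s :: real
  assumes "\<beta> > 0" "s \<ge> 0"
  shows "((\<lambda>t. (s - t) powr (\<beta> - 1)) has_integral s powr \<beta> / \<beta>) {0..s}"
proof (cases "s = 0")
  case False
  have "Beta 1 \<beta> = 1 / \<beta>"
    using assms Gamma_plus1[of \<beta>] Gamma_real_pos[of \<beta>]
    by (cases "\<beta> \<in> \<int>\<^sub>\<le>\<^sub>0")
      (auto simp: Beta_def add.commute elim!: nonpos_Ints_cases dest: less_imp_neq[OF Gamma_real_pos])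
  then show ?thesis
    using has_integral_RL_kernel_power[OF \<open>\<beta> > 0\<close>, of s 0] False assms by simp
qed (use assms has_integral_refl(2)[of _ "0::real"] in simp)

text \<open>For \<beta> < 1 the kernel is unbounded at \<open>t = s\<close>, so the integrand need
  not be continuous there. It is the product of a nonnegative integrable function and a bounded
  measurable one.\<close>

lemma absolutely_integrable_RL:
  fixes \<beta> s :: real and h :: "real \<Rightarrow> real"
  assumes "\<beta> > 0" "s \<ge> 0" "continuous_on {0..s} h"
  shows "(\<lambda>t. (s - t) powr (\<beta> - 1) * h t) absolutely_integrable_on {0..s}"
proof -
  have "(\<lambda>t. h t * (s - t) powr (\<beta> - 1)) absolutely_integrable_on {0..s}"
  proof (rule absolutely_integrable_bounded_measurable_product_real)
    show "h \<in> borel_measurable (lebesgue_on {0..s})"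
      by (rule continuous_imp_measurable_on_sets_lebesgue) (use assms in auto)
    show "bounded (h ` {0..s})"
      by (rule compact_imp_bounded) (use assms compact_continuous_image in auto)
    show "(\<lambda>t. (s - t) powr (\<beta> - 1)) absolutely_integrable_on {0..s}"
      by (rule nonnegative_absolutely_integrable_1)
        (use has_integral_RL_kernel[OF assms(1,2)] in \<open>auto simp: integrable_on_def\<close>)
  qed auto
  then show ?thesis by (simp add: mult.commute)
qed

lemma integrable_RL:
  fixes \<beta> s :: real and h :: "real \<Rightarrow> real"
  assumes "\<beta> > 0" "s \<ge> 0" "continuous_on {0..s} h"
  shows "(\<lambda>t. (s - t) powr (\<beta> - 1) * h t) integrable_on {0..s}"
  using absolutely_integrable_RL[OF assms] by (rule set_lebesgue_integral_eq_integral)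

lemma RL_int_cong:
  assumes "\<And>t. t \<in> {0<..s} \<Longrightarrow> g t = h t"
  shows "RL_int \<beta> g s = RL_int \<beta> h s"
proof -
  have "integral {0..s} (\<lambda>t. (s - t) powr (\<beta> - 1) * g t) = integral {0..s} (\<lambda>t. (s - t) powr (\<beta> - 1) * h t)"
    by (rule integral_spike[of "{0}"]) (use assms in auto)
  then show ?thesis by (simp add: RL_int_def)
qed

lemma RL_int_at_0 [simp]: "RL_int \<beta> h 0 = 0"
  by (simp add: RL_int_def)

lemma RL_int_add:
  assumes "\<beta> > 0" "s \<ge> 0" "continuous_on {0..s} g" "continuous_on {0..s} h"
  shows "RL_int \<beta> (\<lambda>t. g t + h t) s = RL_int \<beta> g s + RL_int \<beta> h s"
  using integral_add[OF integrable_RL[OF assms(1,2,3)] integrable_RL[OF assms(1,2,4)]]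
  by (simp add: RL_int_def distrib_left add_divide_distrib)

lemma RL_int_cmult: "RL_int \<beta> (\<lambda>t. c * h t) s = c * RL_int \<beta> h s"
proof -
  have "(\<lambda>t. (s - t) powr (\<beta> - 1) * (c * h t)) = (\<lambda>t. c * ((s - t) powr (\<beta> - 1) * h t))"
    by (simp add: fun_eq_iff)
  then show ?thesis by (simp add: RL_int_def)
qed

lemma RL_int_diff:
  assumes "\<beta> > 0" "s \<ge> 0" "continuous_on {0..s} g" "continuous_on {0..s} h"
  shows "RL_int \<beta> (\<lambda>t. g t - h t) s = RL_int \<beta> g s - RL_int \<beta> h s"
  using integral_diff[OF integrable_RL[OF assms(1,2,3)] integrable_RL[OF assms(1,2,4)]]
  by (simp add: RL_int_def right_diff_distrib diff_divide_distrib)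

lemma RL_int_sum:
  assumes "\<beta> > 0" "s \<ge> 0" "finite I" "\<And>i. i \<in> I \<Longrightarrow> continuous_on {0..s} (h i)"
  shows "RL_int \<beta> (\<lambda>t. \<Sum>i\<in>I. h i t) s = (\<Sum>i\<in>I. RL_int \<beta> (h i) s)"
  using integral_sum[OF assms(3), of "\<lambda>i t. (s - t) powr (\<beta> - 1) * h i t" "{0..s}"] integrable_RL[OF assms(1,2,4)]
  by (simp add: RL_int_def sum_distrib_left sum_divide_distrib)

lemma RL_int_powr:
  fixes \<beta> \<mu> s :: real
  assumes "\<beta> > 0" "\<mu> > -1" "s \<ge> 0"
  shows "RL_int \<beta> (\<lambda>t. t powr \<mu>) s = Gamma (\<mu> + 1) / Gamma (\<mu> + \<beta> + 1) * s powr (\<mu> + \<beta>)"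
proof (cases "s = 0")
  case False
  have "Gamma \<beta> \<noteq> 0" using Gamma_real_pos[OF assms(1)] by simp
  then show ?thesis
    using integral_unique[OF has_integral_RL_kernel_powr[OF assms(1,2), of s]] False assms
    by (simp add: RL_int_def Beta_def add_ac)
qed simp

lemma RL_int_power:
  assumes "\<beta> > 0" "s \<ge> 0"
  shows "RL_int \<beta> (\<lambda>t. t ^ n) s = fact n / Gamma (n + \<beta> + 1) * s powr (n + \<beta>)"
proof -
  have "RL_int \<beta> (\<lambda>t. t ^ n) s = RL_int \<beta> (\<lambda>t. t powr real n) s"
    by (rule RL_int_cong) (simp add: powr_realpow)
  then show ?thesis using RL_int_powr[OF assms(1), of n s] assms by (simp add: Gamma_fact add_ac)
qed

lemma continuous_on_powr_const:
  fixes p :: real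
  assumes "p > 0"
  shows "continuous_on {0..s} (\<lambda>t. t powr p)"
  using assms by (intro continuous_on_powr' continuous_intros) auto

lemma RL_int_const:
  assumes "\<beta> > 0" "s \<ge> 0"
  shows "RL_int \<beta> (\<lambda>t. c) s = c * (s powr \<beta> / Gamma (\<beta> + 1))"
  using RL_int_cmult[of \<beta> c "\<lambda>_. 1" s] RL_int_power[OF assms, of 0] by simp

lemma RL_int_mono:
  assumes "\<beta> > 0" "s \<ge> 0" "continuous_on {0..s} g" "continuous_on {0..s} h"
    and le: "\<And>t. t \<in> {0..s} \<Longrightarrow> g t \<le> h t"
  shows "RL_int \<beta> g s \<le> RL_int \<beta> h s"
  unfolding RL_int_def
  by (intro divide_right_mono integral_le integrable_RL mult_left_mono assms)
    (use Gamma_real_pos[OF assms(1)] in auto)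

lemma abs_RL_int_le:
  assumes "\<beta> > 0" "s \<ge> 0" "continuous_on {0..s} h" and le: "\<And>t. t \<in> {0..s} \<Longrightarrow> \<bar>h t\<bar> \<le> M"
  shows "\<bar>RL_int \<beta> h s\<bar> \<le> M * (s powr \<beta> / Gamma (\<beta> + 1))"
proof -
  have "RL_int \<beta> h s \<le> RL_int \<beta> (\<lambda>t. M) s" "RL_int \<beta> (\<lambda>t. - M) s \<le> RL_int \<beta> h s"
    using le by (intro RL_int_mono assms; force)+
  then show ?thesis by (simp add: RL_int_const assms)
qed

lemma RL_int_1_eq: "RL_int 1 h s = integral {0..s} h"
proof -
  have "integral {0..s} (\<lambda>t. (s - t) powr (1 - 1) * h t) = integral {0..s} h"
    \<comment> \<open>At \<open>t = s\<close> the kernel reads \<open>0 powr 0\<close>, which is 0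
      and not 1.\<close>
    by (rule integral_spike[of "{s}"]) auto
  then show ?thesis by (simp add: RL_int_def)
qed

section \<open>Polynomial approximation, the semigroup law and injectivity\<close>

lemma polynomial_approximating_sequence:
  fixes h :: "real \<Rightarrow> real"
  assumes "continuous_on {0..L} h"
  obtains c :: "nat \<Rightarrow> nat \<Rightarrow> real" and d :: "nat \<Rightarrow> nat"
  where "\<forall>n. \<forall>t\<in>{0..L}. \<bar>h t - (\<Sum>i\<le>d n. c n i * t ^ i)\<bar> \<le> 1 / Suc n"
proof -
  \<comment> \<open>Coefficients and degree are packed into one pair, so that a single use of
    \<open>choice\<close> yields both sequences.\<close>
  have "\<exists>p. \<forall>t\<in>{0..L}. \<bar>h t - (\<Sum>i\<le>(snd p::nat). fst p i * t ^ i)\<bar> \<le> 1 / Suc n" for n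
  proof -
    obtain g where g: "real_polynomial_function g" "\<And>t. t \<in> {0..L} \<Longrightarrow> \<bar>h t - g t\<bar> < 1 / Suc n"
      using Stone_Weierstrass_real_polynomial_function[of "{0..L}" h "1 / Suc n"] assms by auto
    obtain c d where "g = (\<lambda>t. \<Sum>i\<le>(d::nat). c i * t ^ i)"
      using g(1) unfolding real_polynomial_function_iff_sum by blast
    then show ?thesis using g(2) by (intro exI[of _ "(c, d)"]) (auto intro: less_imp_le)
  qed
  then obtain p where "\<forall>n. \<forall>t\<in>{0..L}. \<bar>h t - (\<Sum>i\<le>(snd (p n)::nat). fst (p n) i * t ^ i)\<bar> \<le> 1 / Suc n"
    using choice[of "\<lambda>n p. \<forall>t\<in>{0..L}. \<bar>h t - (\<Sum>i\<le>(snd p::nat). fst p i * t ^ i)\<bar> \<le> 1 / Suc n"] by blast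
  then show thesis by (rule that[of "\<lambda>n. fst (p n)" "\<lambda>n. snd (p n)"])
qed

text \<open>The bound contains \<open>L\<close> instead of \<open>s\<close> and is thus uniform on
  the interval: uniform approximation of the integrand gives uniform approximation of the fractional
  integral.\<close>

lemma RL_int_approx:
  assumes "\<beta> > 0" "s \<in> {0..L}" "continuous_on {0..L} g" "continuous_on {0..L} h"
    and "\<And>t. t \<in> {0..L} \<Longrightarrow> \<bar>h t - g t\<bar> \<le> \<epsilon>"
  shows "\<bar>RL_int \<beta> h s - RL_int \<beta> g s\<bar> \<le> \<epsilon> * (L powr \<beta> / Gamma (\<beta> + 1))"
proof -
  have cont: "continuous_on {0..s} g" "continuous_on {0..s} h"
    using assms by (auto elim!: continuous_on_subset)
  have "\<epsilon> \<ge> 0" using assms(2) assms(5)[of 0] by auto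
  have "\<bar>RL_int \<beta> (\<lambda>t. h t - g t) s\<bar> \<le> \<epsilon> * (s powr \<beta> / Gamma (\<beta> + 1))"
    using assms cont by (intro abs_RL_int_le continuous_intros) auto
  also have "\<dots> \<le> \<epsilon> * (L powr \<beta> / Gamma (\<beta> + 1))"
    using assms \<open>\<epsilon> \<ge> 0\<close> Gamma_real_pos[of "\<beta> + 1"]
    by (intro mult_left_mono divide_right_mono powr_mono2) auto
  finally show ?thesis using RL_int_diff[of \<beta> s h g] assms cont by auto
qed

lemma RL_int_polynomial:
  assumes "\<beta> > 0" "s \<ge> 0"
  shows "RL_int \<beta> (\<lambda>t. \<Sum>i\<le>d. c i * t ^ i) s
    = (\<Sum>i\<le>d. c i * (fact i / Gamma (i + \<beta> + 1) * s powr (i + \<beta>)))"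
  using assms by (subst RL_int_sum) (auto intro!: continuous_intros simp: RL_int_cmult RL_int_power)

text \<open>Both the kernel and the domain of integration move with \<open>s\<close>. This is
  avoided by taking a uniform limit of fractional integrals of polynomials, which are explicit
  combinations of positive powers.\<close>

lemma continuous_on_RL_int:
  assumes "\<beta> > 0" and h: "continuous_on {0..L} h"
  shows "continuous_on {0..L} (RL_int \<beta> h)"
proof -
  obtain c d where cd: "\<forall>n. \<forall>t\<in>{0..L}. \<bar>h t - (\<Sum>i\<le>d n. c n i * t ^ i)\<bar> \<le> 1 / Suc n"
    by (rule polynomial_approximating_sequence[OF h])
  define P where "P n t = (\<Sum>i\<le>d n. c n i * t ^ i)" for n t
  let ?C = "L powr \<beta> / Gamma (\<beta> + 1)"
  have bound: "\<bar>RL_int \<beta> h s - RL_int \<beta> (P n) s\<bar> \<le> 1 / Suc n * ?C" if "s \<in> {0..L}" for n s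
    by (rule RL_int_approx[OF assms(1) that]) (use h cd in \<open>auto simp: P_def intro!: continuous_intros\<close>)
  have lim0: "(\<lambda>n. 1 / Suc n * ?C) \<longlonglongrightarrow> 0"
    by (rule tendsto_mult_left_zero[OF LIMSEQ_Suc[OF lim_1_over_n]])
  have "uniform_limit {0..L} (\<lambda>n. RL_int \<beta> (P n)) (RL_int \<beta> h) sequentially"
  proof (rule uniform_limitI)
    fix e :: real assume "e > 0"
    then have "\<forall>\<^sub>F n in sequentially. 1 / Suc n * ?C < e" by (rule order_tendstoD(2)[OF lim0])
    then show "\<forall>\<^sub>F n in sequentially. \<forall>s\<in>{0..L}. dist (RL_int \<beta> (P n) s) (RL_int \<beta> h s) < e"
    proof (rule eventually_mono, intro ballI)
      fix n s assume "1 / Suc n * ?C < e" "s \<in> {0..L}"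
      then show "dist (RL_int \<beta> (P n) s) (RL_int \<beta> h s) < e"
        using bound[of s n] unfolding dist_real_def by linarith
    qed
  qed
  moreover have "continuous_on {0..L} (RL_int \<beta> (P n))" for n
  proof -
    have "continuous_on {0..L} (\<lambda>s. \<Sum>i\<le>d n. c n i * (fact i / Gamma (i + \<beta> + 1) * s powr (i + \<beta>)))"
      using assms(1) by (intro continuous_on_sum continuous_on_mult_left continuous_on_powr_const) simp
    then show ?thesis
      using RL_int_polynomial[OF assms(1)] by (subst continuous_on_cong[OF refl]) (auto simp: P_def[abs_def])
  qed
  ultimately show ?thesis
    by (intro uniform_limit_theorem) auto
qed

lemma LIMSEQ_0_if_abs_le_inverse_Suc:
  fixes x :: "nat \<Rightarrow> real"
  assumes "\<And>n. \<bar>x n\<bar> \<le> 1 / Suc n * K"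
  shows "x \<longlonglongrightarrow> 0"
proof (rule Lim_null_comparison[of x "\<lambda>n. 1 / Suc n * K"])
  show "\<forall>\<^sub>F n in sequentially. norm (x n) \<le> 1 / Suc n * K"
    unfolding real_norm_def using assms by (rule always_eventually[OF allI])
  show "(\<lambda>n. 1 / Suc n * K) \<longlonglongrightarrow> 0"
    by (rule tendsto_mult_left_zero[OF LIMSEQ_Suc[OF lim_1_over_n]])
qed

text \<open>On monomials this is the Beta integral; continuous functions are uniform limits of polynomials.\<close>

theorem RL_int_semigroup:
  assumes \<beta>: "\<beta> > 0" and \<gamma>: "\<gamma> > 0" and h: "continuous_on {0..L} h" and s: "s \<in> {0..L}"
  shows "RL_int \<beta> (RL_int \<gamma> h) s = RL_int (\<beta> + \<gamma>) h s"
proof -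
  obtain c d where cd: "\<forall>n. \<forall>t\<in>{0..L}. \<bar>h t - (\<Sum>i\<le>d n. c n i * t ^ i)\<bar> \<le> 1 / Suc n"
    by (rule polynomial_approximating_sequence[OF h])
  define P where "P = (\<lambda>n t. \<Sum>i\<le>d n. c n i * t ^ i)"
  define C where "C \<beta> = L powr \<beta> / Gamma (\<beta> + 1)" for \<beta>
  have contP: "continuous_on {0..L} (P n)" for n by (auto simp: P_def intro!: continuous_intros)
  have approx: "\<bar>RL_int \<beta> h s - RL_int \<beta> (P n) s\<bar> \<le> 1 / Suc n * C \<beta>" if "s \<in> {0..L}" "\<beta> > 0" for n s \<beta>
    unfolding C_def by (rule RL_int_approx[OF that(2,1) contP h]) (use cd in \<open>simp add: P_def\<close>)
  have poly: "RL_int \<beta> (RL_int \<gamma> (P n)) s = RL_int (\<beta> + \<gamma>) (P n) s" for n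
  proof -
    have "RL_int \<beta> (RL_int \<gamma> (P n)) s
      = RL_int \<beta> (\<lambda>t. \<Sum>i\<le>d n. c n i * fact i / Gamma (i + \<gamma> + 1) * t powr (i + \<gamma>)) s"
      using RL_int_polynomial[OF \<gamma>] by (intro RL_int_cong) (simp add: P_def mult.assoc)
    also have "\<dots> = (\<Sum>i\<le>d n. c n i * fact i / Gamma (i + \<gamma> + 1) * RL_int \<beta> (\<lambda>t. t powr (i + \<gamma>)) s)"
      unfolding RL_int_cmult[symmetric]
    proof (rule RL_int_sum)
      fix i :: nat
      show "continuous_on {0..s} (\<lambda>t. c n i * fact i / Gamma (i + \<gamma> + 1) * t powr (i + \<gamma>))"
        using \<gamma> by (intro continuous_on_mult_left continuous_on_powr_const) simp
    qed (use \<beta> s in auto)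
    \<comment> \<open>The factor \<open>Gamma (i + \<gamma> + 1)\<close> appears once as a
      denominator and once as a numerator; it cancels because it is positive.\<close>
    also have "\<dots> = RL_int (\<beta> + \<gamma>) (P n) s"
      unfolding P_def
    proof (subst RL_int_polynomial, goal_cases)
      case 3
      have "real i + \<gamma> + 1 > 0" for i using \<gamma> by linarith
      then have "Gamma (real i + \<gamma> + 1) > 0" for i by (rule Gamma_real_pos)
      then have "Gamma (real i + \<gamma> + 1) \<noteq> 0" for i using less_imp_neq by metis
      then show ?case using \<beta> \<gamma> s by (intro sum.cong) (auto simp: RL_int_powr add_ac)
    qed (use \<beta> \<gamma> s in auto)
    finally show ?thesis .
  qed
  have "(\<lambda>n. RL_int \<beta> (RL_int \<gamma> h) s - RL_int \<beta> (RL_int \<gamma> (P n)) s) \<longlonglongrightarrow> 0"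
  proof (rule LIMSEQ_0_if_abs_le_inverse_Suc)
    fix n
    have "\<bar>RL_int \<beta> (RL_int \<gamma> h) s - RL_int \<beta> (RL_int \<gamma> (P n)) s\<bar> \<le> 1 / Suc n * C \<gamma> * C \<beta>"
      unfolding C_def[of \<beta>]
      by (rule RL_int_approx[OF \<beta> s continuous_on_RL_int[OF \<gamma> contP] continuous_on_RL_int[OF \<gamma> h] approx[OF _ \<gamma>]])
    then show "\<bar>RL_int \<beta> (RL_int \<gamma> h) s - RL_int \<beta> (RL_int \<gamma> (P n)) s\<bar> \<le> 1 / Suc n * (C \<gamma> * C \<beta>)"
      by (simp only: mult.assoc)
  qed
  moreover have "(\<lambda>n. RL_int (\<beta> + \<gamma>) h s - RL_int (\<beta> + \<gamma>) (P n) s) \<longlonglongrightarrow> 0"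
    by (rule LIMSEQ_0_if_abs_le_inverse_Suc, rule approx[OF s]) (use \<beta> \<gamma> in simp)
  \<comment> \<open>By \<open>poly\<close> the approximating terms cancel, which leaves a constant
    sequence with limit 0.\<close>
  ultimately have "(\<lambda>n. RL_int \<beta> (RL_int \<gamma> h) s - RL_int \<beta> (RL_int \<gamma> (P n)) s
      - (RL_int (\<beta> + \<gamma>) h s - RL_int (\<beta> + \<gamma>) (P n) s)) \<longlonglongrightarrow> 0 - 0"
    by (rule tendsto_diff)
  then show ?thesis by (simp add: poly LIMSEQ_const_iff)
qed

text \<open>Applying the integral of the complementary order \<open>1 - \<beta>\<close> turns both
  sides into ordinary integrals by the semigroup law. Differentiating these recovers the continuous
  integrands at every point, end points included.\<close>

lemma RL_int_inject:
  assumes \<beta>: "0 < \<beta>" "\<beta> < 1" and "L > 0" and g: "continuous_on {0..L} g" and h: "continuous_on {0..L} h"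
    and eq: "\<And>s. s \<in> {0..L} \<Longrightarrow> RL_int \<beta> g s = RL_int \<beta> h s" and s: "s \<in> {0..L}"
  shows "g s = h s"
proof -
  have int_eq: "integral {0..x} g = integral {0..x} h" if "x \<in> {0..L}" for x
  proof -
    have "RL_int (1 - \<beta>) (RL_int \<beta> g) x = RL_int (1 - \<beta>) (RL_int \<beta> h) x"
      by (rule RL_int_cong) (use eq that in auto)
    then show ?thesis
      using RL_int_semigroup[of "1 - \<beta>" \<beta> L] g h \<beta> that by (simp add: RL_int_1_eq)
  qed
  have "((\<lambda>x. integral {0..x} g) has_vector_derivative g s) (at s within {0..L})"
    using integral_has_vector_derivative[OF g s] .
  moreover have "((\<lambda>x. integral {0..x} g) has_vector_derivative h s) (at s within {0..L})"
    using integral_has_vector_derivative[OF h s] s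
    by (rule has_vector_derivative_transform[rotated 2]) (use int_eq in auto)
  ultimately show ?thesis
    using vector_derivative_unique_within_closed_interval[of 0 L s] \<open>L > 0\<close> s by simp
qed

section \<open>Positivity and the mean value theorem for the fractional kernel\<close>

lemma RL_int_pos:
  assumes "\<beta> > 0" "s > 0" and q: "continuous_on {0..s} q" and pos: "\<And>t. t \<in> {0<..<s} \<Longrightarrow> q t > 0"
  shows "RL_int \<beta> q s > 0"
proof -
  let ?f = "\<lambda>t. (s - t) powr (\<beta> - 1) * q t"
  \<comment> \<open>Any compact interval inside \<open>{0<..<s}\<close> would do. On it the
    integrand is continuous and has a positive minimum, away from the possible singularity at
    \<open>t = s\<close>.\<close>
  define J where "J = {s / 3..s / 2}"
  have J: "J \<subseteq> {0<..<s}" using \<open>s > 0\<close> by (auto simp: J_def)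
  have contJ: "continuous_on J ?f"
    using J by (intro continuous_intros continuous_on_subset[OF q]) auto
  have "compact J" "J \<noteq> {}" using \<open>s > 0\<close> by (auto simp: J_def)
  then obtain m where m: "m \<in> J" "\<And>t. t \<in> J \<Longrightarrow> ?f m \<le> ?f t"
    using continuous_attains_inf[OF _ _ contJ] by blast
  have "?f m > 0" using m(1) J pos by (auto intro!: mult_pos_pos)
  have q0: "q t \<ge> 0" if "t \<in> {0..s}" for t
  proof (rule continuous_ge_on_closure[of "{0<..<s}" q])
    show "continuous_on (closure {0<..<s}) q" using q \<open>s > 0\<close> by simp
  qed (use that pos less_imp_le \<open>s > 0\<close> in auto)
  have "0 < ?f m * (s / 2 - s / 3)" using \<open>?f m > 0\<close> \<open>s > 0\<close> by simp
  also have "\<dots> = integral J (\<lambda>_. ?f m)" using \<open>s > 0\<close> by (simp add: J_def)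
  also have "\<dots> \<le> integral J ?f"
    using contJ m(2) unfolding J_def by (intro integral_le integrable_continuous_real) auto
  also have "\<dots> \<le> integral {0..s} ?f"
  proof (rule integral_subset_le)
    show "?f integrable_on J" using contJ unfolding J_def by (rule integrable_continuous_real)
    show "?f integrable_on {0..s}" using assms by (intro integrable_RL) auto
  qed (use J q0 in auto)
  finally show ?thesis using Gamma_real_pos[OF assms(1)] by (simp add: RL_int_def)
qed

text \<open>The number \<open>c\<close> is the weighted mean of \<open>h\<close>. If
  \<open>h\<close> missed it on the open interval, connectedness would give \<open>h - c\<close> a
  constant sign there, against positivity of the fractional integral. Working on the open interval
  puts the intermediate point strictly inside.\<close>

lemma RL_int_mean_value:
  assumes "\<beta> > 0" "s > 0" and h: "continuous_on {0..s} h"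
  obtains \<xi> where "\<xi> \<in> {0<..<s}" "RL_int \<beta> h s = h \<xi> * (s powr \<beta> / Gamma (\<beta> + 1))"
proof -
  define w where "w = s powr \<beta> / Gamma (\<beta> + 1)"
  have "w > 0" using assms Gamma_real_pos[of "\<beta> + 1"] by (simp add: w_def)
  define c where "c = RL_int \<beta> h s / w"
  have zero: "RL_int \<beta> h s = RL_int \<beta> (\<lambda>t. c) s"
    using \<open>w > 0\<close> assms by (simp add: RL_int_const c_def w_def[symmetric])
  have "\<exists>\<xi>\<in>{0<..<s}. h \<xi> = c"
  proof (rule ccontr)
    assume none: "\<not> ?thesis"
    have conn: "connected (h ` {0<..<s})"
      by (intro connected_continuous_image continuous_on_subset[OF h]) auto
    have "(\<forall>t\<in>{0<..<s}. h t > c) \<or> (\<forall>t\<in>{0<..<s}. h t < c)"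
    proof (rule ccontr)
      assume "\<not> ?thesis"
      then obtain t1 t2 where "t1 \<in> {0<..<s}" "t2 \<in> {0<..<s}" "h t1 \<le> c" "h t2 \<ge> c" by (auto simp: not_less)
      then have "c \<in> h ` {0<..<s}" using conn unfolding connected_iff_interval by blast
      then show False using none by auto
    qed
    then show False
    proof
      assume "\<forall>t\<in>{0<..<s}. h t > c"
      then have "RL_int \<beta> (\<lambda>t. h t - c) s > 0"
        using assms by (intro RL_int_pos continuous_intros) auto
      then show False using zero assms by (simp add: RL_int_diff)
    next
      assume "\<forall>t\<in>{0<..<s}. h t < c"
      then have "RL_int \<beta> (\<lambda>t. c - h t) s > 0"
        using assms by (intro RL_int_pos continuous_intros) auto
      then show False using zero assms by (simp add: RL_int_diff)
    qed
  qed
  then obtain \<xi> where "\<xi> \<in> {0<..<s}" "h \<xi> = c" by blast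
  then have "RL_int \<beta> h s = h \<xi> * w" using \<open>w > 0\<close> by (simp add: c_def)
  with \<open>\<xi> \<in> {0<..<s}\<close> show thesis unfolding w_def by (rule that)
qed

section \<open>Absolute continuity of the fractional integral\<close>

lemma has_integral_reflect_interval:
  fixes f :: "real \<Rightarrow> real"
  assumes "(f has_integral I) {0..s}"
  shows "((\<lambda>t. f (s - t)) has_integral I) {0..s}"
proof -
  have "((\<lambda>t. f (- t)) has_integral I) {-s..0}"
    using assms has_integral_reflect_real[of f I s 0] by simp
  from has_integral_shift_real_ivl[OF this, of "-s"] show ?thesis by simp
qed

text \<open>After the reflection the weight is independent of \<open>s\<close>, which enters only
  through a translate of \<open>h\<close> and the range of integration.\<close>

lemma RL_int_reflect:
  assumes "\<beta> > 0" "s \<ge> 0" "continuous_on {0..s} h"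
  shows "RL_int \<beta> h s = integral {0..s} (\<lambda>t. t powr (\<beta> - 1) * h (s - t)) / Gamma \<beta>"
  using integral_unique[OF has_integral_reflect_interval[OF integrable_integral[OF integrable_RL[OF assms]]]]
  by (simp add: RL_int_def)

text \<open>With \<open>k 0 = 0\<close> the integral is an average of the translates of \<open>k\<close>, extended by \<open>0\<close> to the left;
  translation does not increase the length of a family of intervals.\<close>

lemma abs_cont_on_RL_int:
  assumes \<beta>: "\<beta> > 0" and "L \<ge> 0" and AC: "abs_cont_on 0 L k" and "k 0 = 0"
  shows "abs_cont_on 0 L (RL_int \<beta> k)"
proof (rule abs_cont_onI)
  fix \<epsilon> :: real assume "\<epsilon> > 0"
  \<comment> \<open>The first summand is the total mass of the weight divided by
    \<open>Gamma \<beta>\<close>. Adding 1 keeps \<open>C\<close> positive even for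
    \<open>L = 0\<close> and makes the final estimate
    \<open>(C - 1) * (\<epsilon> / C) < \<epsilon>\<close> strict.\<close>
  define C where "C = L powr \<beta> / \<beta> / Gamma \<beta> + 1"
  have Gpos: "Gamma \<beta> > 0" using Gamma_real_pos[OF \<beta>] .
  have "C > 0" using \<beta> Gpos by (auto simp: C_def intro!: add_nonneg_pos)
  then have "\<epsilon> / C > 0" using \<open>\<epsilon> > 0\<close> by simp
  obtain \<delta> where "\<delta> > 0" and \<delta>: "\<forall>(P :: nat set) u v. interval_family 0 L P u v \<longrightarrow>
      (\<Sum>i\<in>P. v i - u i) < \<delta> \<longrightarrow> (\<Sum>i\<in>P. \<bar>k (v i) - k (u i)\<bar>) < \<epsilon> / C"
    by (rule abs_cont_onE[OF AC \<open>\<epsilon> / C > 0\<close>])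
  have contk: "continuous_on {0..L} k" by (rule abs_cont_on_imp_continuous_on[OF AC])
  define w where "w t = t powr (\<beta> - 1)" for t
  have w: "(w has_integral L powr \<beta> / \<beta>) {0..L}"
    using has_integral_reflect_interval[OF has_integral_RL_kernel[OF \<beta> \<open>L \<ge> 0\<close>]] by (simp add: w_def[abs_def])
  have absint: "(\<lambda>t. w t * g t) integrable_on {0..L}" if "continuous_on {0..L} g" for g
  proof -
    have "(\<lambda>t. g t * w t) absolutely_integrable_on {0..L}"
    proof (rule absolutely_integrable_bounded_measurable_product_real)
      show "g \<in> borel_measurable (lebesgue_on {0..L})"
        by (rule continuous_imp_measurable_on_sets_lebesgue) (use that in auto)
      show "bounded (g ` {0..L})"
        by (rule compact_imp_bounded) (use that compact_continuous_image in auto)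
      show "w absolutely_integrable_on {0..L}"
        by (rule nonnegative_absolutely_integrable_1) (use w in \<open>auto simp: integrable_on_def w_def\<close>)
    qed auto
    then show ?thesis using set_lebesgue_integral_eq_integral(1) by (simp add: mult.commute)
  qed
  have contm: "continuous_on {0..L} (\<lambda>t. k (max 0 (s - t)))" if "s \<in> {0..L}" for s
    by (rule continuous_on_compose2[OF contk]) (use that in \<open>auto intro!: continuous_intros\<close>)
  \<comment> \<open>The expression \<open>max 0 (s - t)\<close> realises the extension of
    \<open>k\<close> by \<open>k 0 = 0\<close>; the range of integration then no longer depends on
    \<open>s\<close>, so increments in \<open>s\<close> can be taken under the integral.\<close>
  have repr: "RL_int \<beta> k s = integral {0..L} (\<lambda>t. w t * k (max 0 (s - t))) / Gamma \<beta>" if s: "s \<in> {0..L}" for s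
  proof -
    have "integral {0..s} (\<lambda>t. t powr (\<beta> - 1) * k (s - t)) = integral {0..s} (\<lambda>t. w t * k (max 0 (s - t)))"
      by (intro integral_cong) (auto simp: w_def)
    also have "\<dots> = integral {0..L} (\<lambda>t. w t * k (max 0 (s - t)))"
    proof -
      have "integral {0..L} (\<lambda>t. w t * k (max 0 (s - t))) =
        integral {0..s} (\<lambda>t. w t * k (max 0 (s - t))) + integral {s..L} (\<lambda>t. w t * k (max 0 (s - t)))"
        by (rule Henstock_Kurzweil_Integration.integral_combine[symmetric]) (use s absint[OF contm] in auto)
      moreover have "integral {s..L} (\<lambda>t. w t * k (max 0 (s - t))) = integral {s..L} (\<lambda>t. 0)"
        by (intro integral_cong) (auto simp: \<open>k 0 = 0\<close>)
      ultimately show ?thesis by simp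
    qed
    finally show ?thesis
      using s by (subst RL_int_reflect) (auto intro: \<beta> continuous_on_subset[OF contk])
  qed
  have "(\<Sum>i<n. \<bar>RL_int \<beta> k (v i) - RL_int \<beta> k (u i)\<bar>) < \<epsilon>"
    if uv: "interval_family 0 L {..<n} u v" and len: "(\<Sum>i<n. v i - u i) < \<delta>" for n :: nat and u v
  proof -
    have uvL: "u i \<in> {0..L}" "v i \<in> {0..L}" "u i \<le> v i" if "i < n" for i
    proof -
      have "0 \<le> u i \<and> u i \<le> v i \<and> v i \<le> L" using uv that unfolding interval_family_def by blast
      then show "u i \<in> {0..L}" "v i \<in> {0..L}" "u i \<le> v i" by auto
    qed
    define D where "D i t = \<bar>k (max 0 (v i - t)) - k (max 0 (u i - t))\<bar>" for i t
    have contD: "continuous_on {0..L} (D i)" if "i < n" for i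
      unfolding D_def using uvL[OF that] by (intro continuous_intros contm)
    \<comment> \<open>For fixed \<open>t\<close> the map \<open>x \<mapsto> max 0 (x - t)\<close> is
      monotone and does not expand distances, so the moved intervals satisfy the same length bound.
      The estimate holds with one \<delta> for all \<open>t\<close> and can be integrated against
      the weight.\<close>
    have D: "(\<Sum>i<n. D i t) \<le> \<epsilon> / C" if t: "t \<in> {0..L}" for t
    proof -
      have mono: "mono_on {0..L} (\<lambda>x. max 0 (x - t))" by (intro mono_onI) auto
      have img: "(\<lambda>x. max 0 (x - t)) ` {0..L} \<subseteq> {0..L}" using t by auto
      have eq: "min (max 0 (u i - t)) (max 0 (v i - t)) = max 0 (u i - t)"
        "max (max 0 (u i - t)) (max 0 (v i - t)) = max 0 (v i - t)" if "i < n" for i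
        using uvL(3)[OF that] by (simp_all add: max_def min_def)
      note fam = interval_family_monotone_image[OF uv img disjI1[OF mono]]
      have "(\<Sum>i<n. max (max 0 (u i - t)) (max 0 (v i - t)) - min (max 0 (u i - t)) (max 0 (v i - t)))
          \<le> (\<Sum>i<n. v i - u i)"
      proof (rule sum_mono)
        fix i assume "i \<in> {..<n}"
        then have "i < n" by simp
        show "max (max 0 (u i - t)) (max 0 (v i - t)) - min (max 0 (u i - t)) (max 0 (v i - t)) \<le> v i - u i"
          unfolding eq[OF \<open>i < n\<close>] using uvL(3)[OF \<open>i < n\<close>] by linarith
      qed
      then have "(\<Sum>i<n. \<bar>k (max (max 0 (u i - t)) (max 0 (v i - t))) - k (min (max 0 (u i - t)) (max 0 (v i - t)))\<bar>) < \<epsilon> / C"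
        using len by (intro \<delta>[rule_format, OF fam]) linarith
      also have "(\<Sum>i<n. \<bar>k (max (max 0 (u i - t)) (max 0 (v i - t))) - k (min (max 0 (u i - t)) (max 0 (v i - t)))\<bar>)
          = (\<Sum>i<n. D i t)"
        by (intro sum.cong refl) (simp only: D_def eq lessThan_iff)
      finally show ?thesis by simp
    qed
    have "(\<Sum>i<n. \<bar>RL_int \<beta> k (v i) - RL_int \<beta> k (u i)\<bar>) \<le> (\<Sum>i<n. integral {0..L} (\<lambda>t. w t * D i t) / Gamma \<beta>)"
    proof (rule sum_mono)
      fix i assume "i \<in> {..<n}"
      then have i: "i < n" by simp
      note int = absint[OF contm[OF uvL(2)[OF i]]] absint[OF contm[OF uvL(1)[OF i]]]
      have "RL_int \<beta> k (v i) - RL_int \<beta> k (u i)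
        = integral {0..L} (\<lambda>t. w t * k (max 0 (v i - t)) - w t * k (max 0 (u i - t))) / Gamma \<beta>"
        using integral_diff[OF int] repr uvL[OF i] by (simp add: diff_divide_distrib)
      moreover have "\<bar>integral {0..L} (\<lambda>t. w t * k (max 0 (v i - t)) - w t * k (max 0 (u i - t)))\<bar>
         \<le> integral {0..L} (\<lambda>t. w t * D i t)"
        unfolding real_norm_def[symmetric]
      proof (rule Henstock_Kurzweil_Integration.integral_norm_bound_integral)
        show "(\<lambda>t. w t * D i t) integrable_on {0..L}" by (rule absint[OF contD[OF i]])
        show "norm (w t * k (max 0 (v i - t)) - w t * k (max 0 (u i - t))) \<le> w t * D i t" for t
          by (simp add: D_def w_def abs_mult right_diff_distrib[symmetric])
      qed (rule integrable_diff[OF int])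
      ultimately show "\<bar>RL_int \<beta> k (v i) - RL_int \<beta> k (u i)\<bar> \<le> integral {0..L} (\<lambda>t. w t * D i t) / Gamma \<beta>"
        using Gpos by (simp add: divide_right_mono)
    qed
    also have "\<dots> = integral {0..L} (\<lambda>t. w t * (\<Sum>i<n. D i t)) / Gamma \<beta>"
      unfolding sum_distrib_left sum_divide_distrib[symmetric]
      by (subst Henstock_Kurzweil_Integration.integral_sum[symmetric]) (auto intro: absint contD)
    also have "\<dots> \<le> integral {0..L} (\<lambda>t. w t * (\<epsilon> / C)) / Gamma \<beta>"
    proof (rule divide_right_mono[OF integral_le])
      show "(\<lambda>t. w t * (\<Sum>i<n. D i t)) integrable_on {0..L}"
        by (intro absint continuous_on_sum contD) simp
      show "(\<lambda>t. w t * (\<epsilon> / C)) integrable_on {0..L}"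
        by (rule absint) simp
      show "w t * (\<Sum>i<n. D i t) \<le> w t * (\<epsilon> / C)" if "t \<in> {0..L}" for t
        by (rule mult_left_mono[OF D[OF that]]) (simp add: w_def)
    qed (use Gpos in simp)
    also have "\<dots> = (C - 1) * (\<epsilon> / C)"
      using integral_unique[OF w] by (simp add: C_def)
    also have "\<dots> < \<epsilon>" using \<open>C > 0\<close> \<open>\<epsilon> > 0\<close> by (simp add: field_simps)
    finally show ?thesis .
  qed
  then show "\<exists>\<delta>>0. \<forall>(n::nat) u v. interval_family 0 L {..<n} u v \<longrightarrow>
        (\<Sum>i<n. v i - u i) < \<delta> \<longrightarrow> (\<Sum>i<n. \<bar>RL_int \<beta> k (v i) - RL_int \<beta> k (u i)\<bar>) < \<epsilon>"
    using \<open>\<delta> > 0\<close> by blast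
qed

section \<open>Inversion of the Caputo derivative and Taylor expansion\<close>

lemma abs_cont_on_diff_const:
  "abs_cont_on a b (\<lambda>t. k t - c) \<longleftrightarrow> abs_cont_on a b k"
  by (simp add: abs_cont_on_def)

text \<open>The case \<alpha> = 1 is separate because \<open>RL_int 0\<close> is not the identity:
  \<open>Gamma 0 = 0\<close> and division by zero make it 0. There the fundamental theorem alone
  suffices.\<close>

lemma caputo_inversion:
  fixes \<alpha> L :: real
  assumes \<alpha>: "0 < \<alpha>" "\<alpha> \<le> 1" and "L > 0" and AC: "abs_cont_on 0 L k" and h: "continuous_on {0..L} h"
    and N: "negligible N"
    and deriv: "\<And>s. s \<in> {0<..<L} - N \<Longrightarrow>
      ((if \<alpha> = 1 then k else RL_int (1 - \<alpha>) (\<lambda>t. k t - k 0)) has_real_derivative h s) (at s)"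
    and s: "s \<in> {0..L}"
  shows "k s = k 0 + RL_int \<alpha> h s"
proof (cases "\<alpha> = 1")
  case True
  have "(h has_integral (k s - k 0)) {0..s}"
    using deriv s True
    by (intro fundamental_theorem_of_calculus_abs_cont[OF abs_cont_on_subinterval[OF AC] _ N]) auto
  then show ?thesis using True by (simp add: RL_int_1_eq integral_unique)
next
  case False
  let ?F = "RL_int (1 - \<alpha>) (\<lambda>t. k t - k 0)"
  have k: "continuous_on {0..L} (\<lambda>t. k t - k 0)"
    using abs_cont_on_imp_continuous_on[OF AC] by (intro continuous_intros)
  have AC_F: "abs_cont_on 0 L ?F"
    using AC \<alpha> False \<open>L > 0\<close> by (intro abs_cont_on_RL_int) (auto simp: abs_cont_on_diff_const)
  have "?F x = RL_int (1 - \<alpha>) (RL_int \<alpha> h) x" if "x \<in> {0..L}" for x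
  proof -
    have "(h has_integral (?F x - ?F 0)) {0..x}"
      using deriv that False
      by (intro fundamental_theorem_of_calculus_abs_cont[OF abs_cont_on_subinterval[OF AC_F] _ N]) auto
    then have "?F x = RL_int 1 h x" by (simp add: RL_int_1_eq integral_unique)
    also have "\<dots> = RL_int (1 - \<alpha>) (RL_int \<alpha> h) x"
      using RL_int_semigroup[of "1 - \<alpha>" \<alpha> L h x] \<alpha> False h that by simp
    finally show ?thesis .
  qed
  then have "k s - k 0 = RL_int \<alpha> h s"
    using \<alpha> False \<open>L > 0\<close> s by (intro RL_int_inject[where \<beta> = "1 - \<alpha>", OF _ _ _ k continuous_on_RL_int[OF _ h]]) auto
  then show ?thesis by simp
qed

lemma RL_int_taylor:
  fixes k :: "nat \<Rightarrow> real \<Rightarrow> real" and \<alpha> L s :: real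
  assumes \<alpha>: "\<alpha> > 0" and cont: "\<And>j. j \<le> Suc m \<Longrightarrow> continuous_on {0..L} (k j)"
    and step: "\<And>j s. j \<le> m \<Longrightarrow> s \<in> {0..L} \<Longrightarrow> k j s = k j 0 + RL_int \<alpha> (k (Suc j)) s"
    and s: "s \<in> {0<..L}"
  shows "k 0 s = (\<Sum>j\<le>m. s powr (j * \<alpha>) * (k j 0 / Gamma (j * \<alpha> + 1))) + RL_int (Suc m * \<alpha>) (k (Suc m)) s"
  using cont step
proof (induction m)
  case 0
  have "k 0 s = k 0 0 + RL_int \<alpha> (k (Suc 0)) s" by (rule 0(2)) (use s in auto)
  then show ?case using s by simp
next
  case (Suc m)
  let ?\<beta> = "real (Suc m) * \<alpha>"
  have \<beta>: "?\<beta> > 0" using \<alpha> by simp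
  have c: "continuous_on {0..s} (RL_int \<alpha> (k (Suc (Suc m))))"
    using Suc.prems(1) s by (intro continuous_on_RL_int[OF \<alpha>] continuous_on_subset[OF Suc.prems(1)]) auto
  \<comment> \<open>The inversion formula is inserted into the remainder: the constant
    \<open>k (Suc m) 0\<close> integrates to the next Taylor term, and the rest is absorbed into an
    integral whose order is larger by \<open>\<alpha>\<close>.\<close>
  have "RL_int ?\<beta> (k (Suc m)) s = RL_int ?\<beta> (\<lambda>t. k (Suc m) 0 + RL_int \<alpha> (k (Suc (Suc m))) t) s"
    by (rule RL_int_cong, rule Suc.prems(2)) (use s in auto)
  also have "\<dots> = RL_int ?\<beta> (\<lambda>t. k (Suc m) 0) s + RL_int ?\<beta> (RL_int \<alpha> (k (Suc (Suc m)))) s"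
    by (rule RL_int_add[OF \<beta> _ _ c]) (use s in auto)
  also have "\<dots> = s powr ?\<beta> * (k (Suc m) 0 / Gamma (?\<beta> + 1)) + RL_int (?\<beta> + \<alpha>) (k (Suc (Suc m))) s"
    using RL_int_const[OF \<beta>, of s "k (Suc m) 0"] RL_int_semigroup[OF \<beta> \<alpha> Suc.prems(1)[of "Suc (Suc m)"], of s] s
    by simp
  finally have "RL_int ?\<beta> (k (Suc m)) s = s powr ?\<beta> * (k (Suc m) 0 / Gamma (?\<beta> + 1))
     + RL_int (Suc (Suc m) * \<alpha>) (k (Suc (Suc m))) s"
    by (simp add: algebra_simps)
  moreover have "k 0 s = (\<Sum>j\<le>m. s powr (j * \<alpha>) * (k j 0 / Gamma (j * \<alpha> + 1))) + RL_int ?\<beta> (k (Suc m)) s"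
  proof (rule Suc.IH)
    show "continuous_on {0..L} (k j)" if "j \<le> Suc m" for j using that by (intro Suc.prems(1)) simp
    show "k j s = k j 0 + RL_int \<alpha> (k (Suc j)) s" if "j \<le> m" "s \<in> {0..L}" for j s
      using that(1) by (intro Suc.prems(2) that(2)) simp
  qed
  ultimately show ?case by simp
qed

theorem RL_int_taylor_mean_value:
  fixes k :: "nat \<Rightarrow> real \<Rightarrow> real" and \<alpha> L s :: real
  assumes \<alpha>: "\<alpha> > 0" and cont: "\<And>j. j \<le> Suc m \<Longrightarrow> continuous_on {0..L} (k j)"
    and step: "\<And>j s. j \<le> m \<Longrightarrow> s \<in> {0..L} \<Longrightarrow> k j s = k j 0 + RL_int \<alpha> (k (Suc j)) s"
    and s: "s \<in> {0<..L}"
  obtains \<xi> where "\<xi> \<in> {0<..<s}"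
    and "k 0 s = (\<Sum>j\<le>m. s powr (j * \<alpha>) * (k j 0 / Gamma (j * \<alpha> + 1)))
      + s powr (Suc m * \<alpha>) * (k (Suc m) \<xi> / Gamma (Suc m * \<alpha> + 1))"
proof -
  have "real (Suc m) * \<alpha> > 0" "s > 0" "continuous_on {0..s} (k (Suc m))"
    using \<alpha> s by (auto intro: continuous_on_subset[OF cont])
  from RL_int_mean_value[OF this] obtain \<xi> where \<xi>: "\<xi> \<in> {0<..<s}"
    "RL_int (Suc m * \<alpha>) (k (Suc m)) s = k (Suc m) \<xi> * (s powr (Suc m * \<alpha>) / Gamma (Suc m * \<alpha> + 1))" .
  show thesis
  proof (rule that[OF \<xi>(1)])
    have "k 0 s = (\<Sum>j\<le>m. s powr (j * \<alpha>) * (k j 0 / Gamma (j * \<alpha> + 1))) + RL_int (Suc m * \<alpha>) (k (Suc m)) s"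
      by (rule RL_int_taylor[where k = k and L = L and m = m, OF \<alpha> cont step s])
    then show "k 0 s = (\<Sum>j\<le>m. s powr (j * \<alpha>) * (k j 0 / Gamma (j * \<alpha> + 1)))
      + s powr (Suc m * \<alpha>) * (k (Suc m) \<xi> / Gamma (Suc m * \<alpha> + 1))"
      unfolding \<xi>(2) by (simp only: times_divide_eq_right mult.commute)
  qed
qed

subsection \<open>The change of variables\<close>

text \<open>The substitution reducing the operators to \<open>\<rho> = 1\<close> on \<open>[0, L]\<close>; the sign \<open>d\<close> is \<open>1\<close> for the left
  and \<open>-1\<close> for the right version, and \<open>e\<close> is the base point.\<close>

locale power_coordinate =
  fixes a b \<rho> d :: real
  assumes a_nonneg: "0 \<le> a" and a_less_b: "a < b" and \<rho>_pos: "0 < \<rho>" and d: "d = 1 \<or> d = -1"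
begin

definition e :: real where "e = (if d = 1 then a else b)"
definition \<sigma> :: "real \<Rightarrow> real" where "\<sigma> x = d * (x powr \<rho> - e powr \<rho>) / \<rho>"
definition \<psi> :: "real \<Rightarrow> real" where "\<psi> s = (e powr \<rho> + d * \<rho> * s) powr (1 / \<rho>)"
definition L :: real where "L = (b powr \<rho> - a powr \<rho>) / \<rho>"

lemma powr_\<rho>_less: "0 \<le> x \<Longrightarrow> x < y \<Longrightarrow> x powr \<rho> < y powr \<rho>"
  using powr_less_mono2[OF \<rho>_pos] .

lemma powr_\<rho>_inverse: "0 \<le> x \<Longrightarrow> (x powr \<rho>) powr (1 / \<rho>) = x" "0 \<le> x \<Longrightarrow> (x powr (1 / \<rho>)) powr \<rho> = x"
  using \<rho>_pos by (simp_all add: powr_powr)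

lemma L_pos: "L > 0"
  using powr_\<rho>_less[OF a_nonneg a_less_b] \<rho>_pos by (simp add: L_def)

lemma \<psi>_arg_bounds:
  assumes "s \<in> {0..L}"
  shows "e powr \<rho> + d * \<rho> * s \<in> {a powr \<rho>..b powr \<rho>}"
  using assms d \<rho>_pos by (auto simp: e_def L_def field_simps)

lemma \<psi>_arg_bounds_strict:
  assumes "s \<in> {0<..<L}"
  shows "e powr \<rho> + d * \<rho> * s \<in> {a powr \<rho><..<b powr \<rho>}"
  using assms d \<rho>_pos by (auto simp: e_def L_def field_simps)

lemma \<psi>_arg_nonneg: "s \<in> {0..L} \<Longrightarrow> 0 \<le> e powr \<rho> + d * \<rho> * s"
  using \<psi>_arg_bounds[of s] powr_ge_zero[of a \<rho>] unfolding atLeastAtMost_iff by linarith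

lemma \<psi>_\<sigma>: "0 \<le> x \<Longrightarrow> \<psi> (\<sigma> x) = x"
  using d \<rho>_pos powr_\<rho>_inverse(1)[of x] by (auto simp: \<psi>_def \<sigma>_def)

lemma \<sigma>_\<psi>:
  assumes "s \<in> {0..L}"
  shows "\<sigma> (\<psi> s) = s"
proof -
  have "0 \<le> e powr \<rho> + d * \<rho> * s"
    by (rule \<psi>_arg_nonneg[OF assms])
  then show ?thesis
    using d \<rho>_pos powr_\<rho>_inverse(2) by (auto simp: \<psi>_def \<sigma>_def)
qed

lemma \<sigma>_bounds: "x \<in> {a..b} \<Longrightarrow> \<sigma> x \<in> {0..L}"
  using d \<rho>_pos a_nonneg powr_mono2[of \<rho> a x] powr_mono2[of \<rho> x b]
  by (auto simp: \<sigma>_def L_def e_def divide_right_mono)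

lemma \<psi>_bounds:
  assumes "s \<in> {0..L}"
  shows "\<psi> s \<in> {a..b}"
proof -
  let ?y = "e powr \<rho> + d * \<rho> * s"
  have "(a powr \<rho>) powr (1 / \<rho>) \<le> ?y powr (1 / \<rho>)" "?y powr (1 / \<rho>) \<le> (b powr \<rho>) powr (1 / \<rho>)"
    using \<psi>_arg_bounds[OF assms] \<psi>_arg_nonneg[OF assms] \<rho>_pos by (auto intro!: powr_mono2)
  then show ?thesis
    using powr_\<rho>_inverse(1)[of a] powr_\<rho>_inverse(1)[of b] a_nonneg a_less_b by (simp add: \<psi>_def)
qed

lemma \<psi>_bounds_strict:
  assumes "s \<in> {0<..<L}"
  shows "\<psi> s \<in> {a<..<b}"
proof -
  have s: "s \<in> {0..L}" using assms by auto
  have "\<sigma> (\<psi> s) = s" "\<psi> s \<in> {a..b}" using \<sigma>_\<psi>[OF s] \<psi>_bounds[OF s] by auto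
  moreover have "\<sigma> a \<in> {0, L}" "\<sigma> b \<in> {0, L}"
    using d by (auto simp: \<sigma>_def L_def e_def)
  ultimately show ?thesis using assms by (cases "\<psi> s = a \<or> \<psi> s = b") (auto simp: less_le)
qed

lemma \<psi>_0: "\<psi> 0 = e"
  using powr_\<rho>_inverse(1)[of e] a_nonneg a_less_b by (simp add: \<psi>_def e_def)

lemma e_mem: "e \<in> {a..b}" "0 \<le> e"
  using a_nonneg a_less_b by (auto simp: e_def)

lemma \<psi>_mono: "mono_on {0..L} \<psi> \<or> antimono_on {0..L} \<psi>"
proof (cases "d = 1")
  case True
  have "\<psi> s \<le> \<psi> t" if "s \<in> {0..L}" "s \<le> t" for s t
    unfolding \<psi>_def using \<psi>_arg_nonneg[OF that(1)] that(2) True \<rho>_pos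
    by (intro powr_mono2) auto
  then show ?thesis by (auto simp: monotone_on_def)
next
  case False
  then have "d = -1" using d by simp
  have "\<psi> t \<le> \<psi> s" if "t \<in> {0..L}" "s \<le> t" for s t
    unfolding \<psi>_def using \<psi>_arg_nonneg[OF that(1)] that(2) \<open>d = -1\<close> \<rho>_pos
    by (intro powr_mono2) auto
  then show ?thesis by (auto simp: monotone_on_def)
qed

text \<open>The map is a power after an affine function. The affine part is Lipschitz and monotone,
  so the absolute continuity of powers applies even when the base reaches 0.\<close>

lemma abs_cont_on_\<psi>: "abs_cont_on 0 L \<psi>"
  unfolding \<psi>_def
proof (rule abs_cont_on_compose_monotone[of "a powr \<rho>" "b powr \<rho>" "\<lambda>y. y powr (1 / \<rho>)"])
  show "abs_cont_on (a powr \<rho>) (b powr \<rho>) (\<lambda>y. y powr (1 / \<rho>))"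
    using \<rho>_pos by (intro abs_cont_on_powr) auto
  show "abs_cont_on 0 L (\<lambda>s. e powr \<rho> + d * \<rho> * s)"
    using d \<rho>_pos by (intro abs_cont_on_Lipschitz[where K = \<rho>]) (auto simp: algebra_simps)
  show "(\<lambda>s. e powr \<rho> + d * \<rho> * s) ` {0..L} \<subseteq> {a powr \<rho>..b powr \<rho>}"
    using \<psi>_arg_bounds by blast
  show "mono_on {0..L} (\<lambda>s. e powr \<rho> + d * \<rho> * s) \<or> antimono_on {0..L} (\<lambda>s. e powr \<rho> + d * \<rho> * s)"
    using d \<rho>_pos by (auto simp: monotone_on_def)
qed

lemma \<psi>_image: "\<psi> ` {0..L} \<subseteq> {a..b}"
  using \<psi>_bounds by blast

lemma abs_cont_on_compose_\<psi>:
  assumes "abs_cont_on a b g"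
  shows "abs_cont_on 0 L (\<lambda>s. g (\<psi> s))"
  by (rule abs_cont_on_compose_monotone[OF assms abs_cont_on_\<psi> \<psi>_image \<psi>_mono])

lemma continuous_on_compose_\<psi>:
  assumes "continuous_on {a..b} g"
  shows "continuous_on {0..L} (\<lambda>s. g (\<psi> s))"
  by (rule continuous_on_compose2[OF assms abs_cont_on_imp_continuous_on[OF abs_cont_on_\<psi>] \<psi>_image])

section \<open>Derivatives and fractional integrals in the new coordinate\<close>

lemma \<sigma>_has_derivative:
  assumes "x > 0"
  shows "(\<sigma> has_real_derivative d * x powr (\<rho> - 1)) (at x within A)"
proof -
  have "((\<lambda>x. d * (x powr \<rho> - e powr \<rho>) / \<rho>) has_real_derivative d * (\<rho> * x powr (\<rho> - 1)) / \<rho>) (at x)"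
    using \<rho>_pos by (auto intro!: derivative_eq_intros assms)
  then show ?thesis
    using \<rho>_pos by (simp add: \<sigma>_def[abs_def] DERIV_subset[OF _ subset_UNIV])
qed

text \<open>By the chain rule the operator \<open>d * x powr (1 - \<rho>)\<close> times
  \<open>d/dx\<close> becomes plain differentiation in \<open>s\<close>; the sign in the right-sided
  derivative is absorbed by the orientation of the coordinate.\<close>

lemma \<psi>_has_derivative:
  assumes "s \<in> {0<..<L}"
  shows "(\<psi> has_real_derivative d * \<psi> s powr (1 - \<rho>)) (at s)"
proof -
  let ?y = "e powr \<rho> + d * \<rho> * s"
  have y: "?y > 0"
    using \<psi>_arg_bounds_strict[OF assms] le_less_trans[of 0 "a powr \<rho>"] by simp
  have "((\<lambda>s. e powr \<rho> + d * \<rho> * s) has_real_derivative d * \<rho>) (at s)"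
    by (auto intro!: derivative_eq_intros)
  from DERIV_chain2[OF has_real_derivative_powr[OF y, of "1 / \<rho>"] this]
  have "(\<psi> has_real_derivative 1 / \<rho> * ?y powr (1 / \<rho> - 1) * (d * \<rho>)) (at s)"
    by (simp add: \<psi>_def[abs_def])
  moreover have "?y powr (1 / \<rho> - 1) = \<psi> s powr (1 - \<rho>)"
    using \<rho>_pos by (simp add: \<psi>_def powr_powr field_simps)
  ultimately show ?thesis using \<rho>_pos by (simp add: mult.commute)
qed

lemma \<sigma>_image:
  assumes "x \<in> {a..b}"
  shows "\<sigma> ` {min e x<..<max e x} = {0<..<\<sigma> x}"
proof -
  have pos: "y \<ge> 0" if "y \<in> {a..b}" for y using that a_nonneg by simp
  have less: "\<sigma> y < \<sigma> z \<longleftrightarrow> d * y < d * z" if "y \<in> {a..b}" "z \<in> {a..b}" for y z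
    using d \<rho>_pos powr_\<rho>_less[of y z] powr_\<rho>_less[of z y] pos[OF that(1)] pos[OF that(2)]
    by (cases y z rule: linorder_cases) (auto simp: \<sigma>_def divide_less_cancel)
  have "\<sigma> e = 0" by (simp add: \<sigma>_def)
  \<comment> \<open>Multiplication by \<open>d\<close> describes the interval between
    \<open>e\<close> and \<open>x\<close> by the same inequalities in both orientations.\<close>
  have mem: "y \<in> {min e x<..<max e x} \<longleftrightarrow> y \<in> {a..b} \<and> d * e < d * y \<and> d * y < d * x" for y
    using d assms by (auto simp: e_def)
  show ?thesis
  proof (intro equalityI subsetI)
    fix s assume "s \<in> \<sigma> ` {min e x<..<max e x}"
    then obtain y where y: "y \<in> {min e x<..<max e x}" "s = \<sigma> y" by blast
    then have "y \<in> {a..b}" "d * e < d * y" "d * y < d * x" using mem by blast+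
    then have "\<sigma> e < \<sigma> y" "\<sigma> y < \<sigma> x" using less e_mem(1) assms by blast+
    then show "s \<in> {0<..<\<sigma> x}" using \<open>\<sigma> e = 0\<close> y(2) by simp
  next
    fix s assume s: "s \<in> {0<..<\<sigma> x}"
    then have sL: "s \<in> {0..L}" using \<sigma>_bounds[OF assms] by auto
    have "\<sigma> e < \<sigma> (\<psi> s)" "\<sigma> (\<psi> s) < \<sigma> x" using s \<open>\<sigma> e = 0\<close> \<sigma>_\<psi>[OF sL] by simp_all
    then have "d * e < d * \<psi> s" "d * \<psi> s < d * x" using less e_mem(1) assms \<psi>_bounds[OF sL] by blast+
    then have "\<psi> s \<in> {min e x<..<max e x}" using mem \<psi>_bounds[OF sL] by blast
    then show "s \<in> \<sigma> ` {min e x<..<max e x}" by (rule image_eqI[where f = \<sigma> and x = "\<psi> s", OF \<sigma>_\<psi>[OF sL, symmetric]])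
  qed
qed

lemma \<psi>_between:
  assumes "x \<in> {a..b}" "s \<in> {0<..<\<sigma> x}"
  shows "\<psi> s \<in> {min e x<..<max e x}"
proof -
  obtain y where "y \<in> {min e x<..<max e x}" "s = \<sigma> y" using assms \<sigma>_image by blast
  moreover have "0 \<le> y" using calculation(1) assms e_mem(2) a_nonneg by auto
  ultimately show ?thesis by (simp add: \<psi>_\<sigma>)
qed

text \<open>Up to sign, \<open>\<tau> powr (\<rho> - 1)\<close> is the derivative of
  \<open>\<sigma>\<close>, and \<open>d * (x powr \<rho> - \<tau> powr \<rho>)\<close> is
  \<open>\<rho> * (\<sigma> x - \<sigma> \<tau>)\<close>. The resulting power of \<rho> cancels the
  normalising factor. The substitution is made on the open interval, where \<tau> > 0 even if
  \<open>a = 0\<close>.\<close>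

lemma frac_int_eq_RL_int:
  assumes \<beta>: "0 < \<beta>" and g: "continuous_on {a..b} g" and x: "x \<in> {a..b}"
  shows "\<rho> powr (1 - \<beta>) / Gamma \<beta> * (LINT \<tau>:{min e x..max e x}|lebesgue.
        \<tau> powr (\<rho> - 1) * g \<tau> / (d * (x powr \<rho> - \<tau> powr \<rho>)) powr (1 - \<beta>)) = RL_int \<beta> (\<lambda>s. g (\<psi> s)) (\<sigma> x)"
proof -
  let ?I = "{min e x<..<max e x}"
  let ?f = "\<lambda>t. (\<sigma> x - t) powr (\<beta> - 1) * g (\<psi> t)"
  let ?h = "\<lambda>\<tau>. \<tau> powr (\<rho> - 1) * g \<tau> / (d * (x powr \<rho> - \<tau> powr \<rho>)) powr (1 - \<beta>)"
  have \<sigma>x: "\<sigma> x \<in> {0..L}" using \<sigma>_bounds[OF x] .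
  have I: "0 < \<tau>" "\<tau> \<in> {a..b}" if "\<tau> \<in> ?I" for \<tau> using that x e_mem a_nonneg by auto
  have inj: "inj_on \<sigma> ?I"
    by (rule inj_on_inverseI[of _ \<psi>]) (use I in \<open>auto intro!: \<psi>_\<sigma> less_imp_le\<close>)
  have "?f absolutely_integrable_on {0..\<sigma> x}"
    using \<sigma>x by (intro absolutely_integrable_RL[OF \<beta>] continuous_on_subset[OF continuous_on_compose_\<psi>[OF g]]) auto
  then have "?f absolutely_integrable_on {0<..<\<sigma> x}"
    by (simp add: absolutely_integrable_on_Icc_iff_Ioo)
  then have "?f absolutely_integrable_on \<sigma> ` ?I \<and> integral (\<sigma> ` ?I) ?f = integral {0..\<sigma> x} ?f"
    by (simp add: \<sigma>_image[OF x] integral_open_interval_real)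
  then have "(\<lambda>\<tau>. \<bar>d * \<tau> powr (\<rho> - 1)\<bar> * ?f (\<sigma> \<tau>)) absolutely_integrable_on ?I \<and>
      integral ?I (\<lambda>\<tau>. \<bar>d * \<tau> powr (\<rho> - 1)\<bar> * ?f (\<sigma> \<tau>)) = integral {0..\<sigma> x} ?f"
    by (subst has_absolute_integral_change_of_variables_1'[where g = \<sigma> and f = ?f])
      (use I inj in \<open>auto intro!: \<sigma>_has_derivative\<close>)
  then have 1: "(\<lambda>\<tau>. \<bar>d * \<tau> powr (\<rho> - 1)\<bar> * ?f (\<sigma> \<tau>)) absolutely_integrable_on {min e x..max e x}"
      "integral {min e x..max e x} (\<lambda>\<tau>. \<bar>d * \<tau> powr (\<rho> - 1)\<bar> * ?f (\<sigma> \<tau>)) = integral {0..\<sigma> x} ?f"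
    by (simp_all add: absolutely_integrable_on_Icc_iff_Ioo integral_open_interval_real)
  have "?h \<tau> = \<rho> powr (\<beta> - 1) * (\<bar>d * \<tau> powr (\<rho> - 1)\<bar> * ?f (\<sigma> \<tau>))" if "\<tau> \<in> ?I" for \<tau>
  proof -
    have "\<sigma> \<tau> < \<sigma> x" using that \<sigma>_image[OF x] by auto
    moreover have eq: "d * (x powr \<rho> - \<tau> powr \<rho>) = \<rho> * (\<sigma> x - \<sigma> \<tau>)"
      using \<rho>_pos by (simp add: \<sigma>_def field_simps)
    moreover have "y powr (\<beta> - 1) = inverse (y powr (1 - \<beta>))" for y :: real
      using powr_minus[of y "1 - \<beta>"] by simp
    moreover have "\<bar>d * \<tau> powr (\<rho> - 1)\<bar> = \<tau> powr (\<rho> - 1)" using d by auto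
    ultimately show ?thesis
      using \<psi>_\<sigma>[of \<tau>] I[OF that] \<rho>_pos by (simp add: powr_mult divide_inverse)
  qed
  then have spike: "?h \<tau> = \<rho> powr (\<beta> - 1) * (\<bar>d * \<tau> powr (\<rho> - 1)\<bar> * ?f (\<sigma> \<tau>))"
    if "\<tau> \<in> {min e x..max e x} - {e, x}" for \<tau>
  proof -
    have "\<tau> \<in> ?I" using that by (cases "e \<le> x") auto
    then show ?thesis by fact
  qed
  have neg: "negligible {e, x}" by simp
  have "(\<lambda>\<tau>. \<rho> powr (\<beta> - 1) * (\<bar>d * \<tau> powr (\<rho> - 1)\<bar> * ?f (\<sigma> \<tau>))) absolutely_integrable_on {min e x..max e x}"
    by (intro set_integrable_mult_right 1(1))
  then have "?h absolutely_integrable_on {min e x..max e x}"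
    by (rule absolutely_integrable_spike[OF _ neg spike])
  then have "(LINT \<tau>:{min e x..max e x}|lebesgue. ?h \<tau>) = integral {min e x..max e x} ?h"
    by (rule set_lebesgue_integral_eq_integral)
  also have "\<dots> = integral {min e x..max e x} (\<lambda>\<tau>. \<rho> powr (\<beta> - 1) * (\<bar>d * \<tau> powr (\<rho> - 1)\<bar> * ?f (\<sigma> \<tau>)))"
    by (rule integral_spike[OF neg]) (rule spike[symmetric])
  also have "\<dots> = \<rho> powr (\<beta> - 1) * integral {0..\<sigma> x} ?f"
    by (simp only: integral_mult_right 1(2))
  finally have "(LINT \<tau>:{min e x..max e x}|lebesgue. ?h \<tau>) = \<rho> powr (\<beta> - 1) * integral {0..\<sigma> x} ?f" .
  then have "\<rho> powr (1 - \<beta>) / Gamma \<beta> * (LINT \<tau>:{min e x..max e x}|lebesgue. ?h \<tau>)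
      = (\<rho> powr (1 - \<beta>) * \<rho> powr (\<beta> - 1)) * integral {0..\<sigma> x} ?f / Gamma \<beta>" by simp
  also have "\<rho> powr (1 - \<beta>) * \<rho> powr (\<beta> - 1) = 1"
    using powr_add[of \<rho> "1 - \<beta>" "\<beta> - 1"] \<rho>_pos by simp
  finally show ?thesis unfolding RL_int_def mult_1 .
qed

text \<open>The function \<open>F\<close> stands for the left or the right fractional integral. Its
  formula is required only inside the interval, since derivatives are used only at interior points
  and values outside the interval are not controlled.\<close>

lemma caputo_inversion_in_coordinate:
  assumes \<alpha>: "0 < \<alpha>" "\<alpha> \<le> 1" and AC: "abs_cont_on a b g"
    and F: "\<And>x. \<alpha> < 1 \<Longrightarrow> x \<in> {a<..<b} \<Longrightarrow> F x = RL_int (1 - \<alpha>) (\<lambda>t. g (\<psi> t) - g (\<psi> 0)) (\<sigma> x)"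
    and h: "continuous_version a b (\<lambda>x. map_option ((*) d) (gamma_op \<rho> (if \<alpha> = 1 then g else F) x)) h"
    and s: "s \<in> {0..L}"
  shows "g (\<psi> s) = g (\<psi> 0) + RL_int \<alpha> (\<lambda>t. h (\<psi> t)) s"
proof -
  let ?G = "if \<alpha> = 1 then g else F"
  let ?D = "\<lambda>x. map_option ((*) d) (gamma_op \<rho> ?G x)"
  from h have cont: "continuous_on {a..b} h" and AE: "AE x\<in>{a..b} in lebesgue. ?D x = Some (h x)"
    by (simp_all add: continuous_version_def)
  from AE_E[OF AE] obtain N where "{x \<in> space lebesgue. \<not> (x \<in> {a..b} \<longrightarrow> ?D x = Some (h x))} \<subseteq> N"
    and N0: "emeasure lebesgue N = 0" "N \<in> sets lebesgue" .
  then have N: "?D x = Some (h x)" if "x \<in> {a..b}" "x \<notin> N" for x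
    using that by auto
  \<comment> \<open>Restricting to the open interval makes all points positive, where
    \<open>\<sigma>\<close> is differentiable; it therefore maps this null set to a null
    set.\<close>
  let ?M = "N \<inter> {a<..<b}"
  have "negligible N" using N0 by (simp add: negligible_iff_null_sets null_setsI)
  then have "negligible ?M" by (rule negligible_subset) simp
  moreover have "\<sigma> differentiable_on ?M"
    unfolding differentiable_on_def real_differentiable_def
    using a_nonneg by (intro ballI exI) (rule \<sigma>_has_derivative, simp)
  ultimately have neg: "negligible (\<sigma> ` ?M)"
    by (intro negligible_differentiable_image_negligible) simp_all
  have deriv: "((if \<alpha> = 1 then \<lambda>t. g (\<psi> t) else RL_int (1 - \<alpha>) (\<lambda>t. g (\<psi> t) - g (\<psi> 0)))
      has_real_derivative h (\<psi> t)) (at t)" if t: "t \<in> {0<..<L} - \<sigma> ` ?M" for t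
  proof -
    have x: "\<psi> t \<in> {a<..<b}" using \<psi>_bounds_strict t by blast
    have "\<psi> t \<notin> N"
    proof
      assume "\<psi> t \<in> N"
      then have "\<sigma> (\<psi> t) \<in> \<sigma> ` ?M" using x by blast
      then show False using t \<sigma>_\<psi>[of t] by simp
    qed
    moreover have "\<psi> t \<in> {a..b}" using x by simp
    ultimately have "?D (\<psi> t) = Some (h (\<psi> t))" by (intro N)
    then have diff: "?G differentiable (at (\<psi> t))"
      and val: "d * (\<psi> t powr (1 - \<rho>) * deriv ?G (\<psi> t)) = h (\<psi> t)"
      by (auto simp: gamma_op_def split: if_splits)
    have "(?G has_real_derivative deriv ?G (\<psi> t)) (at (\<psi> t))"
      using diff by (simp only: DERIV_deriv_iff_real_differentiable)
    from DERIV_chain2[OF this \<psi>_has_derivative]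
    have "((\<lambda>t. ?G (\<psi> t)) has_real_derivative deriv ?G (\<psi> t) * (d * \<psi> t powr (1 - \<rho>))) (at t)"
      using t by blast
    also have "deriv ?G (\<psi> t) * (d * \<psi> t powr (1 - \<rho>)) = h (\<psi> t)"
      using val by (simp only: ac_simps)
    finally have D: "((\<lambda>t. ?G (\<psi> t)) has_real_derivative h (\<psi> t)) (at t)" .
    show ?thesis
    \<comment> \<open>Replacing the function under the derivative needs equality on a whole
      neighbourhood of \<open>t\<close>, and \<open>{0<..<L}\<close> is one.\<close>
    proof (rule has_field_derivative_transform_within_open[OF D open_greaterThanLessThan])
      show "t \<in> {0<..<L}" using t by blast
      fix r assume r: "r \<in> {0<..<L}"
      then have "\<sigma> (\<psi> r) = r" "\<psi> r \<in> {a<..<b}" using \<sigma>_\<psi>[of r] \<psi>_bounds_strict[of r] by auto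
      then show "?G (\<psi> r) = (if \<alpha> = 1 then \<lambda>t. g (\<psi> t) else RL_int (1 - \<alpha>) (\<lambda>t. g (\<psi> t) - g (\<psi> 0))) r"
        using F[of "\<psi> r"] \<alpha> by simp
    qed
  qed
  show ?thesis
    by (rule caputo_inversion[OF \<alpha> L_pos abs_cont_on_compose_\<psi>[OF AC] continuous_on_compose_\<psi>[OF cont] neg deriv s])
qed

text \<open>The operator \<open>D\<close> is kept abstract, with the sign \<open>d\<close> as a
  factor, so that one argument serves both one-sided derivatives.\<close>

lemma caputo_taylor_mean_value:
  fixes m :: nat and F :: "(real \<Rightarrow> real) \<Rightarrow> real \<Rightarrow> real"
  assumes \<alpha>: "0 < \<alpha>" "\<alpha> \<le> 1"
    and D: "\<And>g. D g = (\<lambda>x. map_option ((*) d) (gamma_op \<rho> (if \<alpha> = 1 then g else F g) x))"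
    and F: "\<And>g x. \<alpha> < 1 \<Longrightarrow> continuous_on {a..b} g \<Longrightarrow> x \<in> {a<..<b} \<Longrightarrow>
      F g x = RL_int (1 - \<alpha>) (\<lambda>t. g (\<psi> t) - g e) (\<sigma> x)"
    and f: "\<forall>j\<le>m + 1. iter_defined a b D j f \<and> iter_in_C a b D j f"
    and x: "x \<in> {a..b}" "x \<noteq> e"
  shows "\<exists>\<xi>\<in>{min e x<..<max e x}.
    f x = (\<Sum>j=0..m. \<sigma> x powr (real j * \<alpha>) * (iter_op a b D j f e / Gamma (real j * \<alpha> + 1)))
      + \<sigma> x powr (real (m + 1) * \<alpha>) * (iter_op a b D (m + 1) f \<xi> / Gamma (real (m + 1) * \<alpha> + 1))"
proof -
  define k where "k j t = iter_op a b D j f (\<psi> t)" for j t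
  \<comment> \<open>The iterate is a \<open>SOME\<close> choice; membership in \<open>C[a,b]\<close>
    supplies the existence that makes the chosen function an actual continuous version.\<close>
  have version: "continuous_version a b (D (iter_op a b D j f)) (iter_op a b D (Suc j) f)" if "j \<le> m" for j
  proof -
    have "iter_in_C a b D (Suc j) f" using f that by auto
    then show ?thesis unfolding iter_in_C.simps iter_op.simps by (rule someI_ex)
  qed
  note version' = version[unfolded D[of "iter_op a b D j f" for j]]
  have AC: "abs_cont_on a b (iter_op a b D j f)" if "j \<le> m" for j
  proof -
    have "iter_defined a b D (m + 1) f" using f by blast
    then show ?thesis using that by (simp add: iter_defined_def)
  qed
  have cont: "continuous_on {0..L} (k j)" if "j \<le> Suc m" for j
  proof -
    have "continuous_on {a..b} (iter_op a b D j f)"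
    proof (cases j)
      case 0
      then show ?thesis using AC[of 0] abs_cont_on_imp_continuous_on by blast
    next
      case (Suc i)
      then show ?thesis using version[of i] that by (simp add: continuous_version_def)
    qed
    then show ?thesis unfolding k_def by (rule continuous_on_compose_\<psi>)
  qed
  have step: "k j s = k j 0 + RL_int \<alpha> (k (Suc j)) s" if "j \<le> m" "s \<in> {0..L}" for j s
    unfolding k_def
  proof (rule caputo_inversion_in_coordinate[OF \<alpha> AC[OF that(1)] _ version'[OF that(1)] that(2)])
    fix y assume y: "\<alpha> < 1" "y \<in> {a<..<b}"
    show "F (iter_op a b D j f) y
        = RL_int (1 - \<alpha>) (\<lambda>t. iter_op a b D j f (\<psi> t) - iter_op a b D j f (\<psi> 0)) (\<sigma> y)"
      unfolding \<psi>_0 by (rule F[OF y(1) abs_cont_on_imp_continuous_on[OF AC[OF that(1)]] y(2)])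
  qed
  have x0: "0 \<le> x" using x a_nonneg by simp
  have "\<sigma> x \<noteq> 0" using \<psi>_\<sigma>[OF x0] \<psi>_0 x(2) by metis
  then have "\<sigma> x \<in> {0<..L}" using \<sigma>_bounds[OF x(1)] by simp
  from RL_int_taylor_mean_value[where k = k, OF \<alpha>(1) cont step this]
  obtain \<xi> where \<xi>: "\<xi> \<in> {0<..<\<sigma> x}"
    "k 0 (\<sigma> x) = (\<Sum>j\<le>m. \<sigma> x powr (j * \<alpha>) * (k j 0 / Gamma (j * \<alpha> + 1)))
      + \<sigma> x powr (Suc m * \<alpha>) * (k (Suc m) \<xi> / Gamma (Suc m * \<alpha> + 1))" .
  have k: "k 0 (\<sigma> x) = f x" "\<And>j. k j 0 = iter_op a b D j f e" "k (m + 1) \<xi> = iter_op a b D (m + 1) f (\<psi> \<xi>)"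
    by (simp_all add: k_def \<psi>_0 \<psi>_\<sigma>[OF x0])
  show ?thesis
    by (rule bexI[OF _ \<psi>_between[OF x(1) \<xi>(1)]]) (use \<xi>(2) in \<open>simp only: Suc_eq_plus1 k atLeast0AtMost\<close>)
qed

end

section \<open>Both one-sided expansions, from the orientations \<open>d = 1\<close> and
  \<open>d = -1\<close>\<close>

theorem theorem4:
  fixes a b \<rho> \<alpha> :: real and m :: nat and f :: "real \<Rightarrow> real"
  assumes "0 \<le> a" and "a < b" and "\<rho> > 0" and "0 < \<alpha>" and "\<alpha> \<le> 1"
  shows
    "((\<forall>j\<le>m + 1. iter_defined a b (caputo_left \<alpha> \<rho> a) j f \<and>
                  iter_in_C a b (caputo_left \<alpha> \<rho> a) j f) \<longrightarrow>
      (\<forall>x\<in>{a<..b}. \<exists>\<xi>\<in>{a<..<x}.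
        f x = (\<Sum>j=0..m. ((x powr \<rho> - a powr \<rho>) / \<rho>) powr (real j * \<alpha>) *
                 (caputo_left_iter \<alpha> \<rho> a b j f a / Gamma (real j * \<alpha> + 1)))
            + ((x powr \<rho> - a powr \<rho>) / \<rho>) powr (real (m + 1) * \<alpha>) *
                 (caputo_left_iter \<alpha> \<rho> a b (m + 1) f \<xi> / Gamma (real (m + 1) * \<alpha> + 1))))
     \<and>
     ((\<forall>j\<le>m + 1. iter_defined a b (caputo_right \<alpha> \<rho> b) j f \<and>
                  iter_in_C a b (caputo_right \<alpha> \<rho> b) j f) \<longrightarrow>
      (\<forall>x\<in>{a..<b}. \<exists>\<xi>\<in>{x<..<b}.
        f x = (\<Sum>j=0..m. ((b powr \<rho> - x powr \<rho>) / \<rho>) powr (real j * \<alpha>) *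
                 (caputo_right_iter \<alpha> \<rho> a b j f b / Gamma (real j * \<alpha> + 1)))
            + ((b powr \<rho> - x powr \<rho>) / \<rho>) powr (real (m + 1) * \<alpha>) *
                 (caputo_right_iter \<alpha> \<rho> a b (m + 1) f \<xi> / Gamma (real (m + 1) * \<alpha> + 1))))"
proof (intro conjI impI ballI)
  interpret left: power_coordinate a b \<rho> 1
    using assms by unfold_locales auto
  have e: "left.e = a" by (simp add: left.e_def)
  have \<sigma>: "left.\<sigma> x = (x powr \<rho> - a powr \<rho>) / \<rho>" for x by (simp add: left.\<sigma>_def e)
  fix x assume f: "\<forall>j\<le>m + 1. iter_defined a b (caputo_left \<alpha> \<rho> a) j f \<and> iter_in_C a b (caputo_left \<alpha> \<rho> a) j f"
    and x: "x \<in> {a<..b}"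
  have id_eq: "(*) (1::real) = id" by (simp add: fun_eq_iff)
  have D: "caputo_left \<alpha> \<rho> a g = (\<lambda>x. map_option ((*) 1) (gamma_op \<rho> (if \<alpha> = 1 then g
      else frac_int_left (1 - \<alpha>) \<rho> a (\<lambda>t. g t - g a)) x))" for g
    by (simp add: caputo_left_def id_eq option.map_id)
  have F: "frac_int_left (1 - \<alpha>) \<rho> a (\<lambda>t. g t - g a) y
      = RL_int (1 - \<alpha>) (\<lambda>t. g (left.\<psi> t) - g left.e) (left.\<sigma> y)"
    if "\<alpha> < 1" "continuous_on {a..b} g" "y \<in> {a<..<b}" for g y
    using left.frac_int_eq_RL_int[of "1 - \<alpha>" "\<lambda>t. g t - g a" y] that
    by (simp add: frac_int_left_def e min_absorb1 max_absorb2 continuous_intros)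
  show "\<exists>\<xi>\<in>{a<..<x}. f x = (\<Sum>j=0..m. ((x powr \<rho> - a powr \<rho>) / \<rho>) powr (real j * \<alpha>) *
                 (caputo_left_iter \<alpha> \<rho> a b j f a / Gamma (real j * \<alpha> + 1)))
            + ((x powr \<rho> - a powr \<rho>) / \<rho>) powr (real (m + 1) * \<alpha>) *
                 (caputo_left_iter \<alpha> \<rho> a b (m + 1) f \<xi> / Gamma (real (m + 1) * \<alpha> + 1))"
    using left.caputo_taylor_mean_value[OF assms(4,5) D F f, of x] x
    by (simp only: caputo_left_iter_def e \<sigma>) simp
next
  interpret right: power_coordinate a b \<rho> "-1"
    using assms by unfold_locales auto
  have e: "right.e = b" by (simp add: right.e_def)
  have \<sigma>: "right.\<sigma> x = (b powr \<rho> - x powr \<rho>) / \<rho>" for x by (simp add: right.\<sigma>_def e)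
  fix x assume f: "\<forall>j\<le>m + 1. iter_defined a b (caputo_right \<alpha> \<rho> b) j f \<and> iter_in_C a b (caputo_right \<alpha> \<rho> b) j f"
    and x: "x \<in> {a..<b}"
  have uminus_eq: "(*) (-1::real) = uminus" by (simp add: fun_eq_iff)
  have D: "caputo_right \<alpha> \<rho> b g = (\<lambda>x. map_option ((*) (-1)) (gamma_op \<rho> (if \<alpha> = 1 then g
      else frac_int_right (1 - \<alpha>) \<rho> b (\<lambda>t. g t - g b)) x))" for g
    by (simp add: caputo_right_def uminus_eq if_distrib if_distribR)
  have F: "frac_int_right (1 - \<alpha>) \<rho> b (\<lambda>t. g t - g b) y
      = RL_int (1 - \<alpha>) (\<lambda>t. g (right.\<psi> t) - g right.e) (right.\<sigma> y)"
    if "\<alpha> < 1" "continuous_on {a..b} g" "y \<in> {a<..<b}" for g y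
    using right.frac_int_eq_RL_int[of "1 - \<alpha>" "\<lambda>t. g t - g b" y] that
    by (simp add: frac_int_right_def e min_absorb2 max_absorb1 continuous_intros)
  show "\<exists>\<xi>\<in>{x<..<b}. f x = (\<Sum>j=0..m. ((b powr \<rho> - x powr \<rho>) / \<rho>) powr (real j * \<alpha>) *
                 (caputo_right_iter \<alpha> \<rho> a b j f b / Gamma (real j * \<alpha> + 1)))
            + ((b powr \<rho> - x powr \<rho>) / \<rho>) powr (real (m + 1) * \<alpha>) *
                 (caputo_right_iter \<alpha> \<rho> a b (m + 1) f \<xi> / Gamma (real (m + 1) * \<alpha> + 1))"
    using right.caputo_taylor_mean_value[OF assms(4,5) D F f, of x] x
    by (simp only: caputo_right_iter_def e \<sigma>) simp
qed

end
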